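(* Let $0<\gamma<2$, $\gamma\neq4/3$, and assume $V$ and $\chi$ are positive functions of class $C^3$ on $\mathbb{R}$. For $p\in\Sigma$ let $O^-(p)$ be the past orbit of $p$ under the flow of the system $(\ast)$ (see context). Then for almost all $p\in\Sigma$ (i.e. outside a subset of $\Sigma$ of measure zero with respect to the natural 3-dimensional measure on $\Sigma$), the scalar field $\phi$ is unbounded on $O^-(p)$.
   Context: The system $(\ast)$ is the autonomous system (prime $=d/d\tau$): $x'=\tfrac12 x(2y^2+\gamma z^2)$; $y'=y^3+\tfrac12(\gamma z^2-2)y-\frac{x^2V'(\phi)}{3\sqrt6}+\frac{(4-3\gamma)z^2}{2\sqrt6}\frac{\chi'(\phi)}{\chi(\phi)}$; $z'=\tfrac12 z(2y^2+(z^2-1)\gamma)-\frac{(4-3\gamma)yz}{2\sqrt6}\frac{\chi'(\phi)}{\chi(\phi)}$; $\phi'=\sqrt{2/3}\,y$, on the state space $\Sigma=\{(x,y,z,\phi)\in\mathbb{R}^4: x\ge0,\ z\ge0,\ y^2+z^2+\tfrac13x^2V(\phi)=1\}$ (a 3-dimensional set). *)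

theory Defs
  imports "HOL-Analysis.Analysis"
begin

type_synonym state = "real \<times> real \<times> real \<times> real"  (* (x, y, z, phi) *)

definition C3 :: "(real \<Rightarrow> real) \<Rightarrow> bool" where
  "C3 f \<longleftrightarrow>
     (\<forall>t. (f has_real_derivative deriv f t) (at t)) \<and>
     (\<forall>t. (deriv f has_real_derivative deriv (deriv f) t) (at t)) \<and>
     (\<forall>t. (deriv (deriv f) has_real_derivative deriv (deriv (deriv f)) t) (at t)) \<and>
     continuous_on UNIV (deriv (deriv (deriv f)))"

definition ode_field :: "real \<Rightarrow> (real \<Rightarrow> real) \<Rightarrow> (real \<Rightarrow> real) \<Rightarrow> state \<Rightarrow> state" where
  "ode_field \<gamma> V \<kappa> = (\<lambda>(x, y, z, \<phi>).
     ( 1/2 * x * (2 * y^2 + \<gamma> * z^2),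
       y^3 + 1/2 * (\<gamma> * z^2 - 2) * y - x^2 * deriv V \<phi> / (3 * sqrt 6)
         + (4 - 3 * \<gamma>) * z^2 / (2 * sqrt 6) * (deriv \<kappa> \<phi> / \<kappa> \<phi>),
       1/2 * z * (2 * y^2 + (z^2 - 1) * \<gamma>)
         - (4 - 3 * \<gamma>) * y * z / (2 * sqrt 6) * (deriv \<kappa> \<phi> / \<kappa> \<phi>),
       sqrt (2/3) * y ))"

definition Sigma_state :: "(real \<Rightarrow> real) \<Rightarrow> state set" where
  "Sigma_state V = {(x, y, z, \<phi>). x \<ge> 0 \<and> z \<ge> 0 \<and> y^2 + z^2 + 1/3 * x^2 * V \<phi> = 1}"

text \<open>Past orbit of p: all points reached at some non-positive time t by a solution
  of (*) on [t, 0] passing through p at time 0 (the vector field is C^2, hence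
  solutions are unique, so this is the past half of the maximal orbit through p).\<close>
definition past_orbit :: "real \<Rightarrow> (real \<Rightarrow> real) \<Rightarrow> (real \<Rightarrow> real) \<Rightarrow> state \<Rightarrow> state set" where
  "past_orbit \<gamma> V \<kappa> p = {q. \<exists>t0 \<le> 0. \<exists>u :: real \<Rightarrow> state.
      u 0 = p \<and> u t0 = q \<and>
      (\<forall>t\<in>{t0..0}. (u has_vector_derivative ode_field \<gamma> V \<kappa> (u t)) (at t within {t0..0}))}"

definition phi_of :: "state \<Rightarrow> real" where
  "phi_of p = snd (snd (snd p))"

text \<open>Coordinate chart of Sigma: projection (x,y,z,phi) to (y,z,phi); it is injective on Sigma
  and null sets of the natural 3-dimensional measure on Sigma correspond to
  Lebesgue null sets of the projection.\<close>
definition chart :: "state \<Rightarrow> real \<times> real \<times> real" where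
  "chart p = snd p"

end

theory Submission
  imports Defs
begin

text \<open>
  Suppose that \<open>\<phi>\<close> is bounded on the past orbit of a point of \<open>\<Sigma>\<close>. Then the orbit stays in a
  compact set and is defined for all negative times. The points with \<open>z = 0\<close> form a null set, so let
  \<open>z > 0\<close>. Monotonicity of \<open>x\<close> and of \<open>ln z + (4 - 3\<gamma>)/4 ln \<kappa>\<close> (up to an integrable error) yields
  \<open>x \<rightarrow> 0\<close>, \<open>y \<rightarrow> 0\<close>, \<open>z \<rightarrow> 1\<close> and \<open>A(\<phi>) \<rightarrow> 0\<close> in the past, where
  \<open>A = (4 - 3\<gamma>)/(2\<surd>6) \<kappa>'/\<kappa>\<close>; moreover \<open>A'\<close> is constant, say \<open>\<alpha>\<close>, on the limit set of \<open>\<phi>\<close>.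
  The linearisation there has eigenvalue \<open>\<gamma>/2\<close> in the direction of \<open>x\<close>, and its block in \<open>(y, \<phi>)\<close> has
  trace \<open>\<gamma>/2 - 1 < 0\<close>, hence always a direction which expands in the past. An indefinite quadratic
  form of the difference of two such orbits therefore satisfies a cone condition: \<open>y\<close> is a
  Lipschitz function of \<open>(x, \<phi>)\<close> on the set of points whose past orbit stays in a small
  neighbourhood of the limit set. Flowing back to time 0 by Gronwall, the set in question is a
  countable union of Lipschitz images of subsets of a plane.
\<close>

subsection \<open>Differential inequalities and negligible sets\<close>

text \<open>Invariant manifold theorems do not apply directly. A null set requires only one
  direction that expands in the past, and the negative trace supplies it for every sign of \<alpha>.
  Two orbits near the limit set are compared with each other, never with an equilibrium, so no base
  point enters. That \<open>A'\<close> is constant on the limit set is what lets a single quadratic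
  form serve for all of it: if \<phi> keeps oscillating between two values, then \<open>A\<close>
  vanishes between them and \<alpha> = 0. The second obstacle is countability. The constants of the
  quadratic form depend on \<alpha>, hence on the orbit, and could take uncountably many values. The
  cover is therefore indexed only by the bound for \<phi>, the size of the neighbourhood, the entry
  time and an interval for \<phi>, all rounded to natural or rational numbers. For each index it is
  enough that some suitable form exists.\<close>

lemma gronwall_le:
  fixes f :: "real \<Rightarrow> real"
  assumes "a \<le> b"
    and d: "\<And>t. a \<le> t \<Longrightarrow> t \<le> b \<Longrightarrow> (f has_real_derivative f' t) (at t within {a..b})"
    and le: "\<And>t. a \<le> t \<Longrightarrow> t \<le> b \<Longrightarrow> f' t \<le> k * f t"
  shows "f b \<le> f a * exp (k * (b - a))"
proof -
  \<comment> \<open>\<open>h\<close> is nonincreasing whatever the signs of \<open>f\<close> and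
    \<open>k\<close>; the quadratic form will use k < 0, the distance of two orbits k \<ge>
    0.\<close>
  define h where "h t = f t * exp (- k * t)" for t
  have hd: "(h has_real_derivative (f' t - k * f t) * exp (- k * t)) (at t within {a..b})"
    if "a \<le> t" "t \<le> b" for t
    unfolding h_def using d[OF that] by (auto intro!: derivative_eq_intros simp: algebra_simps)
  have "h b \<le> h a"
  proof (rule DERIV_nonpos_imp_decreasing_open[OF \<open>a \<le> b\<close>])
    show "continuous_on {a..b} h"
      by (rule DERIV_continuous_on) (use hd in auto)
    fix t assume t: "a < t" "t < b"
    have "(h has_real_derivative (f' t - k * f t) * exp (- k * t)) (at t)"
      using hd[of t] t at_within_Icc_at[of a t b] by simp
    moreover have "(f' t - k * f t) * exp (- k * t) \<le> 0"
      using le[of t] t by (simp add: mult_nonpos_nonneg)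
    ultimately show "\<exists>y. (h has_real_derivative y) (at t) \<and> y \<le> 0" by blast
  qed
  then have "f b * exp (- k * b) * exp (k * b) \<le> f a * exp (- k * a) * exp (k * b)"
    unfolding h_def by (rule mult_right_mono) simp
  then show ?thesis
    by (simp add: mult.assoc flip: exp_add) (simp add: algebra_simps)
qed

text \<open>Only the sign of the factor matters: it carries positivity, nonnegativity and vanishing
  from \<open>b\<close> back to \<open>a\<close>. This serves for x, for z and for the constraint
  that defines \<Sigma>.\<close>

lemma linear_ode_factor:
  fixes f g :: "real \<Rightarrow> real"
  assumes "a \<le> b"
    and d: "\<And>t. a \<le> t \<Longrightarrow> t \<le> b \<Longrightarrow> (f has_real_derivative f t * g t) (at t within {a..b})"
    and g: "continuous_on {a..b} g"
  obtains e where "e > 0" "f a = f b * e"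
proof -
  define G where "G t = integral {a..t} g" for t
  have Gd: "(G has_real_derivative g t) (at t within {a..b})" if "a \<le> t" "t \<le> b" for t
    unfolding G_def has_real_derivative_iff_has_vector_derivative
    using integral_has_vector_derivative[OF g] that by simp
  have "\<exists>c. \<forall>t\<in>{a..b}. f t * exp (- G t) = c"
  proof (rule has_field_derivative_zero_constant)
    show "((\<lambda>t. f t * exp (- G t)) has_real_derivative 0) (at t within {a..b})" if "t \<in> {a..b}" for t
      using that d[of t] Gd[of t] by (auto intro!: derivative_eq_intros)
  qed simp
  then have "f a * exp (- G a) = f b * exp (- G b)" using \<open>a \<le> b\<close> by force
  then have "f a = f b * exp (G a - G b)"
    by (simp add: exp_diff exp_minus field_simps)
  then show ?thesis using that[of "exp (G a - G b)"] by simp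
qed

text \<open>Where \<open>f t\<close> is large, the slope bound keeps \<open>f\<close> above half
  that value on an interval of proportional length to the left of t, so \<open>E\<close> drops there
  by a multiple of \<open>(f t)^2\<close>. The drop still available, \<open>E t - l\<close>, tends
  to 0 in the past.\<close>

lemma barbalat:
  fixes E f :: "real \<Rightarrow> real"
  assumes E: "\<And>t. t \<le> T \<Longrightarrow> (E has_real_derivative E' t) (at t)"
    and le: "\<And>t. t \<le> T \<Longrightarrow> f t \<le> E' t" and nn: "\<And>t. t \<le> T \<Longrightarrow> 0 \<le> f t"
    and f: "\<And>t. t \<le> T \<Longrightarrow> (f has_real_derivative f' t) (at t)"
    and L: "\<And>t. t \<le> T \<Longrightarrow> \<bar>f' t\<bar> \<le> L"
    and bnd: "\<And>t. t \<le> T \<Longrightarrow> m \<le> E t"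
  shows "(f \<longlongrightarrow> 0) at_bot"
proof -
  define K where "K = max L 1"
  define l where "l = Inf (E ` {..T})"
  have bb: "bdd_below (E ` {..T})" using bnd by (auto intro!: bdd_belowI)
  have El: "l \<le> E t" if "t \<le> T" for t
    unfolding l_def using that by (intro cInf_lower bb) auto
  have mono: "E s \<le> E t" if "s \<le> t" "t \<le> T" for s t
    using that le nn E by (intro DERIV_nonneg_imp_nondecreasing[OF that(1)]) (meson order_trans)
  have key: "(f t)\<^sup>2 \<le> 4 * K * (E t - l)" if t: "t \<le> T" for t
  proof (cases "f t = 0")
    case True then show ?thesis using El[OF t] by (simp add: K_def)
  next
    case False
    then have pos: "f t > 0" using nn[OF t] by simp
    \<comment> \<open>Over a time of length h the function f changes upwards by at most h K = f t /
      2.\<close>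
    define h where "h = f t / (2 * K)"
    have K: "K > 0" by (simp add: K_def)
    have h: "h > 0" using pos K by (simp add: h_def)
    obtain \<xi> where \<xi>: "t - h < \<xi>" "\<xi> < t" "E t - E (t - h) = h * E' \<xi>"
      using MVT2[of "t - h" t E E'] E h t by fastforce
    have "\<exists>\<zeta>. \<xi> < \<zeta> \<and> \<zeta> < t \<and> f t - f \<xi> = (t - \<xi>) * f' \<zeta>"
      using \<xi> t by (intro MVT2) (auto intro!: f)
    then obtain \<zeta> where \<zeta>: "\<xi> < \<zeta>" "\<zeta> < t" "f t - f \<xi> = (t - \<xi>) * f' \<zeta>" by blast
    have "f' \<zeta> \<le> K" using L[of \<zeta>] \<zeta> t by (auto simp: K_def)
    then have "(t - \<xi>) * f' \<zeta> \<le> h * K"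
      using \<xi> h K by (smt (verit) mult_left_mono mult_right_mono)
    then have "f t / 2 \<le> f \<xi>" using \<zeta> K by (simp add: h_def)
    also have "\<dots> \<le> E' \<xi>" using le \<xi> t by simp
    finally have "h * (f t / 2) \<le> E t - E (t - h)" using \<xi> h by simp
    also have "\<dots> \<le> E t - l" using El[of "t - h"] h t by simp
    finally show ?thesis using K by (simp add: h_def field_simps power2_eq_square)
  qed
  show ?thesis
  proof (rule tendstoI)
    fix e :: real assume e: "e > 0"
    define d where "d = e\<^sup>2 / (4 * K)"
    have K: "K > 0" by (simp add: K_def)
    have "d > 0" using e K by (simp add: d_def)
    then have "Inf (E ` {..T}) < l + d" by (simp add: l_def)
    then obtain t0 where t0: "t0 \<le> T" "E t0 < l + d"
      using cInf_lessD[of "E ` {..T}" "l + d"] by auto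
    have "dist (f t) 0 < e" if t: "t \<le> t0" for t
    proof -
      have "E t - l < d" using mono[OF t t0(1)] t0 by simp
      then have "4 * K * (E t - l) < e\<^sup>2" using K by (simp add: d_def field_simps)
      then have "(f t)\<^sup>2 < e\<^sup>2" using key[of t] t t0 by simp
      then show ?thesis using e nn[of t] t t0 by (simp add: power2_less_imp_less)
    qed
    then show "eventually (\<lambda>t. dist (f t) 0 < e) at_bot"
      unfolding eventually_at_bot_linorder by blast
  qed
qed

text \<open>The estimate makes \<open>g u\<close> a Lipschitz function of \<open>f u\<close>. Both
  values have the same type because Lipschitz maps preserve null sets when the dimension of the
  target is not smaller than that of the source.\<close>

lemma negligible_expanding:
  fixes f g :: "'i \<Rightarrow> 'a::euclidean_space"
  assumes neg: "negligible (f ` U)"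
    and le: "\<And>u v. u \<in> U \<Longrightarrow> v \<in> U \<Longrightarrow> norm (g u - g v) \<le> C * norm (f u - f v)"
  shows "negligible (g ` U)"
proof -
  define h where "h = g \<circ> inv_into U f"
  have inv: "inv_into U f (f u) \<in> U" "f (inv_into U f (f u)) = f u" if "u \<in> U" for u
    using that by (auto simp: inv_into_into f_inv_into_f)
  have hg: "h (f u) = g u" if "u \<in> U" for u
    using le[OF inv(1)[OF that] that] inv(2)[OF that] by (simp add: h_def)
  have "negligible (h ` f ` U)"
  proof (rule negligible_locally_Lipschitz_image[OF _ neg])
    fix x assume "x \<in> f ` U"
    have "\<forall>y \<in> f ` U \<inter> UNIV. norm (h y - h x) \<le> C * norm (y - x)"
      using \<open>x \<in> f ` U\<close> le hg by auto
    then show "\<exists>T B. open T \<and> x \<in> T \<and> (\<forall>y \<in> f ` U \<inter> T. norm (h y - h x) \<le> B * norm (y - x))"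
      using open_UNIV by blast
  qed simp
  moreover have "h ` f ` U = g ` U" using hg by (auto simp: image_image)
  ultimately show ?thesis by simp
qed

subsection \<open>Global solutions of Lipschitz differential equations\<close>

lemma integral_has_vector_derivative_atLeast:
  fixes f :: "real \<Rightarrow> 'a::banach"
  assumes f: "continuous_on {0..} f" and t: "0 \<le> t"
  shows "((\<lambda>t. integral {0..t} f) has_vector_derivative f t) (at t within {0..})"
proof -
  have "((\<lambda>t. integral {0..t} f) has_vector_derivative f t) (at t within {0..t+1})"
    using t by (intro integral_has_vector_derivative continuous_on_subset[OF f]) auto
  moreover have "at t within {0..t+1} = at t within {0..}"
    by (rule at_within_nhd[of t "{..<t+1}"]) (use t in auto)
  ultimately show ?thesis by simp
qed

text \<open>Picard iteration in the norm weighted by \<open>exp (- k t)\<close>, which is a contraction on the whole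
  half-line.\<close>
lemma global_forward_solution:
  fixes G :: "'a::euclidean_space \<Rightarrow> 'a"
  assumes lip: "\<And>a b. norm (G a - G b) \<le> L * norm (a - b)"
    and bnd: "\<And>a. norm (G a) \<le> M"
  obtains v where "v 0 = p"
    "\<And>t. 0 \<le> t \<Longrightarrow> (v has_vector_derivative G (v t)) (at t within {0..})"
proof -
  \<comment> \<open>The contraction factor will be |L| / k, which is at most 1/2.\<close>
  define k where "k = 2 * \<bar>L\<bar> + 1"
  have k: "k > 0" by (simp add: k_def)
  have lip': "norm (G a - G b) \<le> \<bar>L\<bar> * norm (a - b)" for a b
    by (rule order_trans[OF lip]) (simp add: mult_right_mono)
  have "M \<ge> 0" using bnd[of 0] norm_ge_zero order_trans by blast
  have Gc: "continuous_on UNIV G"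
    by (rule lipschitz_on_continuous_on[of "\<bar>L\<bar>"]) (auto simp: lipschitz_on_def dist_norm lip')
  \<comment> \<open>The unknown \<open>v\<close> stands for exp(-k t) u t, where u is the solution
    sought: the weighted norm of u is the supremum norm of v.\<close>
  define g where "g v s = G (exp (k * s) *\<^sub>R apply_bcontfun v s)" for v :: "real \<Rightarrow>\<^sub>C 'a" and s
  define I where "I v t = integral {0..t} (g v)" for v t
  \<comment> \<open>\<open>max t 0\<close> extends the iterate by the constant p to negative times,
    since bounded continuous functions form a type only over all reals here.\<close>
  define S where "S v t = exp (- k * max t 0) *\<^sub>R (p + I v (max t 0))" for v t
  have gc: "continuous_on X (g v)" for v X
    unfolding g_def by (intro continuous_on_compose2[OF Gc] continuous_intros) auto
  have Id: "(I v has_vector_derivative g v t) (at t within {0..})" if "0 \<le> t" for v t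
    unfolding I_def by (rule integral_has_vector_derivative_atLeast[OF gc that])
  have Ic: "continuous_on {0..} (I v)" for v
    unfolding continuous_on_eq_continuous_within
    using Id has_vector_derivative_continuous by fastforce
  have Sc: "continuous_on UNIV (S v)" for v
    unfolding S_def by (intro continuous_intros continuous_on_compose2[OF Ic]) auto
  have expb: "exp (- k * t) * t \<le> 1 / k" for t
  proof -
    have "k * t \<le> exp (k * t)" using exp_ge_add_one_self[of "k*t"] by linarith
    then show ?thesis using k by (simp add: exp_minus field_simps)
  qed
  have Sb: "norm (S v t) \<le> norm p + M / k" for v t
  proof -
    define m where "m = max t 0"
    have m: "m \<ge> 0" by (simp add: m_def)
    have "norm (I v m) \<le> M * (m - 0)"
      unfolding I_def using m bnd by (intro integral_bound gc) (auto simp: g_def)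
    then have "exp (- k * m) * norm (I v m) \<le> M * (exp (- k * m) * m)"
      by (simp add: field_simps)
    also have "\<dots> \<le> M * (1 / k)" using expb \<open>M \<ge> 0\<close> by (rule mult_left_mono)
    finally have 1: "exp (- k * m) * norm (I v m) \<le> M / k" by simp
    have "exp (- k * m) * norm p \<le> 1 * norm p" using m k by (intro mult_right_mono) auto
    moreover have "norm (S v t) \<le> exp (- k * m) * (norm p + norm (I v m))"
      unfolding S_def m_def by (simp add: norm_triangle_ineq)
    ultimately show ?thesis using 1 by (simp add: algebra_simps)
  qed
  define T where "T v = Bcontfun (S v)" for v
  have Tapp: "apply_bcontfun (T v) = S v" for v
    unfolding T_def by (rule Bcontfun_inverse) (rule bcontfun_normI[OF Sc Sb])
  have contr: "dist (T v) (T w) \<le> 1/2 * dist v w" for v w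
  proof (rule dist_bound)
    fix t :: real
    define m where "m = max t 0"
    have m: "m \<ge> 0" by (simp add: m_def)
    define d where "d = dist v w"
    have "d \<ge> 0" by (simp add: d_def)
    have "((\<lambda>s. \<bar>L\<bar> * d * exp (k * s)) has_integral \<bar>L\<bar> * d * exp (k * m) / k - \<bar>L\<bar> * d * exp (k * 0) / k) {0..m}"
      using k m by (intro fundamental_theorem_of_calculus)
        (auto intro!: derivative_eq_intros simp flip: has_real_derivative_iff_has_vector_derivative)
    then have hi: "((\<lambda>s. \<bar>L\<bar> * d * exp (k * s)) has_integral \<bar>L\<bar> * d * (exp (k * m) - 1) / k) {0..m}"
      by (simp add: right_diff_distrib diff_divide_distrib)
    have gi: "g v integrable_on {0..m}" for v by (rule integrable_continuous_interval[OF gc])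
    have "norm (I v m - I w m) = norm (integral {0..m} (\<lambda>s. g v s - g w s))"
      unfolding I_def by (simp add: integral_diff gi)
    also have "\<dots> \<le> integral {0..m} (\<lambda>s. \<bar>L\<bar> * d * exp (k * s))"
    proof (rule integral_norm_bound_integral)
      show "(\<lambda>s. g v s - g w s) integrable_on {0..m}" using gi by (intro integrable_diff)
      show "(\<lambda>s. \<bar>L\<bar> * d * exp (k * s)) integrable_on {0..m}" using hi by blast
      fix s :: real
      have "norm (g v s - g w s) \<le> \<bar>L\<bar> * norm (exp (k * s) *\<^sub>R (apply_bcontfun v s - apply_bcontfun w s))"
        unfolding g_def scaleR_right_diff_distrib by (rule lip')
      also have "\<dots> = \<bar>L\<bar> * (exp (k * s) * dist (apply_bcontfun v s) (apply_bcontfun w s))"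
        by (simp add: dist_norm)
      also have "\<dots> \<le> \<bar>L\<bar> * (exp (k * s) * d)"
        unfolding d_def by (intro mult_left_mono dist_bounded) auto
      finally show "norm (g v s - g w s) \<le> \<bar>L\<bar> * d * exp (k * s)" by (simp add: mult_ac)
    qed
    also have "\<dots> = \<bar>L\<bar> * d * (exp (k * m) - 1) / k" using hi by (rule integral_unique)
    also have "\<dots> \<le> \<bar>L\<bar> * d * exp (k * m) / k"
      using k \<open>d \<ge> 0\<close> by (intro divide_right_mono mult_left_mono) auto
    finally have I: "norm (I v m - I w m) \<le> \<bar>L\<bar> * d * exp (k * m) / k" .
    have "dist (S v t) (S w t) = norm (exp (- k * m) *\<^sub>R (I v m - I w m))"
      unfolding S_def m_def dist_norm by (simp flip: scaleR_right_diff_distrib)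
    also have "\<dots> = exp (- k * m) * norm (I v m - I w m)" by simp
    also have "\<dots> \<le> exp (- k * m) * (\<bar>L\<bar> * d * exp (k * m) / k)"
      using I by (intro mult_left_mono) auto
    also have "\<dots> = \<bar>L\<bar> / k * d" by (simp add: exp_minus)
    also have "\<dots> \<le> 1/2 * d"
      using \<open>d \<ge> 0\<close> by (intro mult_right_mono) (auto simp: k_def field_simps)
    finally show "dist (apply_bcontfun (T v) t) (apply_bcontfun (T w) t) \<le> 1/2 * dist v w"
      by (simp add: Tapp d_def)
  qed
  have "\<exists>!v. T v = v"
    by (rule banach_fix_type[of "1/2"]) (use contr in auto)
  then obtain v where v: "T v = v" by blast
  define u where "u t = p + I v t" for t
  have vS: "apply_bcontfun v t = exp (- k * t) *\<^sub>R u t" if "0 \<le> t" for t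
    using Tapp[of v] that by (simp add: v S_def u_def)
  have gu: "g v t = G (u t)" if "0 \<le> t" for t
    unfolding g_def vS[OF that] by (simp flip: exp_add)
  show thesis
  proof
    show "u 0 = p" by (simp add: u_def I_def)
    show "(u has_vector_derivative G (u t)) (at t within {0..})" if "0 \<le> t" for t
    proof -
      have "((\<lambda>t. p + I v t) has_vector_derivative 0 + g v t) (at t within {0..})"
        by (intro has_vector_derivative_add has_vector_derivative_const Id that)
      then show ?thesis using gu[OF that] by (simp add: u_def[abs_def])
    qed
  qed
qed

lemma global_past_solution:
  fixes F :: "'a::euclidean_space \<Rightarrow> 'a"
  assumes "\<And>a b. norm (F a - F b) \<le> L * norm (a - b)" "\<And>a. norm (F a) \<le> M"
  obtains u where "u 0 = p"
    "\<And>t. t \<le> 0 \<Longrightarrow> (u has_vector_derivative F (u t)) (at t within {..0})"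
proof -
  obtain v where v: "v 0 = p"
    "\<And>t. 0 \<le> t \<Longrightarrow> (v has_vector_derivative - F (v t)) (at t within {0..})"
    using global_forward_solution[of "\<lambda>a. - F a" L M p] assms
    by (auto simp: norm_minus_commute)
  show thesis
  proof
    show "(v \<circ> uminus) 0 = p" using v by simp
    fix t :: real assume t: "t \<le> 0"
    have im: "uminus ` {..0::real} = {0..}" by simp
    have "((v \<circ> uminus) has_vector_derivative (-1) *\<^sub>R (- F (v (- t)))) (at t within {..0})"
      by (rule vector_diff_chain_within)
        (use t v(2)[of "- t"] in \<open>auto simp: im intro!: derivative_eq_intros\<close>)
    then show "((v \<circ> uminus) has_vector_derivative F ((v \<circ> uminus) t)) (at t within {..0})"
      by simp
  qed
qed

subsection \<open>Bounded Lipschitz functions\<close>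

text \<open>The bound on the size is what makes the class closed under products, so that polynomial
  expressions in the coordinates can be treated term by term.\<close>

definition bounded_lipschitz_on :: "'a::metric_space set \<Rightarrow> ('a \<Rightarrow> real) \<Rightarrow> bool" where
  "bounded_lipschitz_on S f \<longleftrightarrow>
     (\<exists>C\<ge>0. \<forall>p\<in>S. \<bar>f p\<bar> \<le> C \<and> (\<forall>q\<in>S. \<bar>f p - f q\<bar> \<le> C * dist p q))"

lemma bounded_lipschitz_onE:
  assumes "bounded_lipschitz_on S f"
  obtains C where "C \<ge> 0" "\<And>p. p \<in> S \<Longrightarrow> \<bar>f p\<bar> \<le> C"
    "\<And>p q. p \<in> S \<Longrightarrow> q \<in> S \<Longrightarrow> \<bar>f p - f q\<bar> \<le> C * dist p q"
  using assms unfolding bounded_lipschitz_on_def by blast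

lemma bounded_lipschitz_onI:
  assumes "\<And>p. p \<in> S \<Longrightarrow> \<bar>f p\<bar> \<le> C" 
    "\<And>p q. p \<in> S \<Longrightarrow> q \<in> S \<Longrightarrow> \<bar>f p - f q\<bar> \<le> D * dist p q"
  shows "bounded_lipschitz_on S f"
  unfolding bounded_lipschitz_on_def
proof (intro exI[of _ "max \<bar>C\<bar> \<bar>D\<bar>"] conjI ballI)
  show "\<bar>f p - f q\<bar> \<le> max \<bar>C\<bar> \<bar>D\<bar> * dist p q" if "p \<in> S" "q \<in> S" for p q
    by (rule order_trans[OF assms(2)[OF that]]) (rule mult_right_mono, auto)
qed (use assms(1) in force)+

lemma bounded_lipschitz_on_const: "bounded_lipschitz_on S (\<lambda>_. c)"
  by (rule bounded_lipschitz_onI[of _ _ "\<bar>c\<bar>" 0]) auto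

lemma bounded_lipschitz_on_add:
  assumes "bounded_lipschitz_on S f" "bounded_lipschitz_on S g"
  shows "bounded_lipschitz_on S (\<lambda>p. f p + g p)"
proof -
  obtain C where C: "C \<ge> 0" "\<And>p. p \<in> S \<Longrightarrow> \<bar>f p\<bar> \<le> C"
    "\<And>p q. p \<in> S \<Longrightarrow> q \<in> S \<Longrightarrow> \<bar>f p - f q\<bar> \<le> C * dist p q"
    by (rule bounded_lipschitz_onE[OF assms(1)]) blast
  obtain D where D: "D \<ge> 0" "\<And>p. p \<in> S \<Longrightarrow> \<bar>g p\<bar> \<le> D"
    "\<And>p q. p \<in> S \<Longrightarrow> q \<in> S \<Longrightarrow> \<bar>g p - g q\<bar> \<le> D * dist p q"
    by (rule bounded_lipschitz_onE[OF assms(2)]) blast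
  show ?thesis
  proof (rule bounded_lipschitz_onI)
    fix p assume "p \<in> S"
    then show "\<bar>f p + g p\<bar> \<le> C + D" using C(2) D(2) by (meson abs_triangle_ineq add_mono order_trans)
    fix q assume "q \<in> S"
    have "\<bar>f p + g p - (f q + g q)\<bar> \<le> \<bar>f p - f q\<bar> + \<bar>g p - g q\<bar>" by simp
    also have "\<dots> \<le> C * dist p q + D * dist p q" using C D \<open>p \<in> S\<close> \<open>q \<in> S\<close> by (intro add_mono) auto
    finally show "\<bar>f p + g p - (f q + g q)\<bar> \<le> (C + D) * dist p q" by (simp add: algebra_simps)
  qed
qed

lemma abs_diff_mult_le:
  fixes a b c d :: real
  shows "\<bar>a * b - c * d\<bar> \<le> \<bar>a\<bar> * \<bar>b - d\<bar> + \<bar>d\<bar> * \<bar>a - c\<bar>"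
proof -
  have "a * b - c * d = a * (b - d) + d * (a - c)" by (simp add: algebra_simps)
  then show ?thesis by (metis abs_mult abs_triangle_ineq)
qed

lemma bounded_lipschitz_on_mult:
  assumes "bounded_lipschitz_on S f" "bounded_lipschitz_on S g"
  shows "bounded_lipschitz_on S (\<lambda>p. f p * g p)"
proof -
  obtain C where C: "C \<ge> 0" "\<And>p. p \<in> S \<Longrightarrow> \<bar>f p\<bar> \<le> C"
    "\<And>p q. p \<in> S \<Longrightarrow> q \<in> S \<Longrightarrow> \<bar>f p - f q\<bar> \<le> C * dist p q"
    by (rule bounded_lipschitz_onE[OF assms(1)]) blast
  obtain D where D: "D \<ge> 0" "\<And>p. p \<in> S \<Longrightarrow> \<bar>g p\<bar> \<le> D"
    "\<And>p q. p \<in> S \<Longrightarrow> q \<in> S \<Longrightarrow> \<bar>g p - g q\<bar> \<le> D * dist p q"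
    by (rule bounded_lipschitz_onE[OF assms(2)]) blast
  show ?thesis
  proof (rule bounded_lipschitz_onI)
    fix p assume p: "p \<in> S"
    show "\<bar>f p * g p\<bar> \<le> C * D" unfolding abs_mult using C D p by (intro mult_mono) auto
    fix q assume q: "q \<in> S"
    have "\<bar>f p * g p - f q * g q\<bar> \<le> \<bar>f p\<bar> * \<bar>g p - g q\<bar> + \<bar>g q\<bar> * \<bar>f p - f q\<bar>"
      by (rule abs_diff_mult_le)
    also have "\<dots> \<le> C * (D * dist p q) + D * (C * dist p q)"
      using C D p q by (intro add_mono mult_mono) auto
    finally show "\<bar>f p * g p - f q * g q\<bar> \<le> (2 * C * D) * dist p q" by (simp add: algebra_simps)
  qed
qed

lemma bounded_lipschitz_on_uminus:
  "bounded_lipschitz_on S f \<Longrightarrow> bounded_lipschitz_on S (\<lambda>p. - f p)"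
  using bounded_lipschitz_on_mult[OF bounded_lipschitz_on_const[of S "-1"]] by simp

lemma bounded_lipschitz_on_diff:
  "bounded_lipschitz_on S f \<Longrightarrow> bounded_lipschitz_on S g \<Longrightarrow> bounded_lipschitz_on S (\<lambda>p. f p - g p)"
  using bounded_lipschitz_on_add[OF _ bounded_lipschitz_on_uminus] by fastforce

lemma bounded_lipschitz_on_power:
  "bounded_lipschitz_on S f \<Longrightarrow> bounded_lipschitz_on S (\<lambda>p. f p ^ n)"
  by (induction n) (auto intro: bounded_lipschitz_on_const bounded_lipschitz_on_mult)

lemma bounded_lipschitz_on_divide_const:
  "bounded_lipschitz_on S f \<Longrightarrow> bounded_lipschitz_on S (\<lambda>p. f p / c)"
  using bounded_lipschitz_on_mult[OF _ bounded_lipschitz_on_const[of S "1/c"]] by simp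

lemma bounded_lipschitz_on_C1:
  assumes d: "\<And>t. (h has_real_derivative h' t) (at t)" and c: "continuous_on UNIV h'"
  shows "bounded_lipschitz_on {-B..B} h"
proof -
  have "bounded (h ` {-B..B})" 
    by (rule compact_imp_bounded[OF compact_continuous_image])
      (auto intro: DERIV_continuous_on has_field_derivative_at_within d)
  then obtain C where C: "\<And>t. t \<in> {-B..B} \<Longrightarrow> \<bar>h t\<bar> \<le> C"
    unfolding bounded_iff by (metis imageI real_norm_def)
  have "bounded (h' ` {-B..B})" 
    by (rule compact_imp_bounded[OF compact_continuous_image]) (auto intro: continuous_on_subset[OF c])
  then obtain D where D: "\<And>t. t \<in> {-B..B} \<Longrightarrow> \<bar>h' t\<bar> \<le> D"
    unfolding bounded_iff by (metis imageI real_norm_def)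
  show ?thesis
  proof (rule bounded_lipschitz_onI[OF C])
    show "\<bar>h p - h q\<bar> \<le> D * dist p q" if "p \<in> {-B..B}" "q \<in> {-B..B}" for p q
      using field_differentiable_bound[of "{-B..B}" h h' D p q] D d that
      by (auto simp: dist_norm intro: has_field_derivative_at_within)
  qed
qed

lemma bounded_lipschitz_on_compose:
  assumes "bounded_lipschitz_on T h" "\<And>p. p \<in> S \<Longrightarrow> f p \<in> T"
    and "\<And>p q. p \<in> S \<Longrightarrow> q \<in> S \<Longrightarrow> dist (f p) (f q) \<le> dist p q"
  shows "bounded_lipschitz_on S (\<lambda>p. h (f p))"
proof -
  obtain C where C: "C \<ge> 0" "\<And>p. p \<in> T \<Longrightarrow> \<bar>h p\<bar> \<le> C"
    "\<And>p q. p \<in> T \<Longrightarrow> q \<in> T \<Longrightarrow> \<bar>h p - h q\<bar> \<le> C * dist p q"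
    by (rule bounded_lipschitz_onE[OF assms(1)]) blast
  show ?thesis
  proof (rule bounded_lipschitz_onI)
    fix p assume p: "p \<in> S"
    show "\<bar>h (f p)\<bar> \<le> C" using C assms(2) p by auto
    fix q assume q: "q \<in> S"
    show "\<bar>h (f p) - h (f q)\<bar> \<le> C * dist p q"
      using C(3)[of "f p" "f q"] assms(2,3) p q mult_left_mono[OF assms(3)[OF p q] C(1)] by fastforce
  qed
qed

section \<open>Functions whose size and Lipschitz constant are of order \<eta>\<close>

text \<open>Membership in \<open>S \<eta>\<close> is meant to force some coordinates to have size at most \<open>\<eta>\<close>; the
  typical example of a small function is a product of two such coordinates.\<close>
definition small_lipschitz :: "(real \<Rightarrow> 'a::metric_space set) \<Rightarrow> ('a \<Rightarrow> real) \<Rightarrow> bool" where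
  "small_lipschitz S f \<longleftrightarrow> (\<exists>C\<ge>0. \<forall>\<eta>\<in>{0<..1}. \<forall>p\<in>S \<eta>.
     \<bar>f p\<bar> \<le> C * \<eta> \<and> (\<forall>q\<in>S \<eta>. \<bar>f p - f q\<bar> \<le> C * \<eta> * dist p q))"

lemma small_lipschitzE:
  assumes "small_lipschitz S f"
  obtains C where "C \<ge> 0" "\<And>\<eta> p. 0 < \<eta> \<Longrightarrow> \<eta> \<le> 1 \<Longrightarrow> p \<in> S \<eta> \<Longrightarrow> \<bar>f p\<bar> \<le> C * \<eta>"
    "\<And>\<eta> p q. 0 < \<eta> \<Longrightarrow> \<eta> \<le> 1 \<Longrightarrow> p \<in> S \<eta> \<Longrightarrow> q \<in> S \<eta> \<Longrightarrow> \<bar>f p - f q\<bar> \<le> C * \<eta> * dist p q"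
  using assms unfolding small_lipschitz_def by force

lemma small_lipschitz_add:
  assumes "small_lipschitz S f" "small_lipschitz S g"
  shows "small_lipschitz S (\<lambda>p. f p + g p)"
proof -
  obtain C where C: "C \<ge> 0" "\<And>\<eta> p. 0 < \<eta> \<Longrightarrow> \<eta> \<le> 1 \<Longrightarrow> p \<in> S \<eta> \<Longrightarrow> \<bar>f p\<bar> \<le> C * \<eta>"
    "\<And>\<eta> p q. 0 < \<eta> \<Longrightarrow> \<eta> \<le> 1 \<Longrightarrow> p \<in> S \<eta> \<Longrightarrow> q \<in> S \<eta> \<Longrightarrow> \<bar>f p - f q\<bar> \<le> C * \<eta> * dist p q"
    by (rule small_lipschitzE[OF assms(1)]) blast
  obtain D where D: "D \<ge> 0" "\<And>\<eta> p. 0 < \<eta> \<Longrightarrow> \<eta> \<le> 1 \<Longrightarrow> p \<in> S \<eta> \<Longrightarrow> \<bar>g p\<bar> \<le> D * \<eta>"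
    "\<And>\<eta> p q. 0 < \<eta> \<Longrightarrow> \<eta> \<le> 1 \<Longrightarrow> p \<in> S \<eta> \<Longrightarrow> q \<in> S \<eta> \<Longrightarrow> \<bar>g p - g q\<bar> \<le> D * \<eta> * dist p q"
    by (rule small_lipschitzE[OF assms(2)]) blast
  show ?thesis unfolding small_lipschitz_def
  proof (intro exI[of _ "C + D"] conjI ballI)
    show "0 \<le> C + D" using C D by simp
    fix \<eta> :: real and p assume e: "\<eta> \<in> {0<..1}" and p: "p \<in> S \<eta>"
    then show "\<bar>f p + g p\<bar> \<le> (C + D) * \<eta>" 
      using C(2)[of \<eta> p] D(2)[of \<eta> p] by (simp add: algebra_simps)
    fix q assume q: "q \<in> S \<eta>"
    show "\<bar>f p + g p - (f q + g q)\<bar> \<le> (C + D) * \<eta> * dist p q"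
      using C(3)[of \<eta> p q] D(3)[of \<eta> p q] e p q by (simp add: algebra_simps)
  qed
qed

text \<open>An ideal property: each term of the product estimate keeps one factor \<eta>. The second
  function is controlled on the union of all \<open>S \<eta>\<close>, so its constant does not
  depend on \<eta>.\<close>

lemma small_lipschitz_mult:
  assumes "small_lipschitz S f" "bounded_lipschitz_on (\<Union>\<eta>\<in>{0<..1}. S \<eta>) g"
  shows "small_lipschitz S (\<lambda>p. f p * g p)"
proof -
  obtain C where C: "C \<ge> 0" "\<And>\<eta> p. 0 < \<eta> \<Longrightarrow> \<eta> \<le> 1 \<Longrightarrow> p \<in> S \<eta> \<Longrightarrow> \<bar>f p\<bar> \<le> C * \<eta>"
    "\<And>\<eta> p q. 0 < \<eta> \<Longrightarrow> \<eta> \<le> 1 \<Longrightarrow> p \<in> S \<eta> \<Longrightarrow> q \<in> S \<eta> \<Longrightarrow> \<bar>f p - f q\<bar> \<le> C * \<eta> * dist p q"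
    by (rule small_lipschitzE[OF assms(1)]) blast
  obtain D where D: "D \<ge> 0" "\<And>p. p \<in> (\<Union>\<eta>\<in>{0<..1}. S \<eta>) \<Longrightarrow> \<bar>g p\<bar> \<le> D"
    "\<And>p q. p \<in> (\<Union>\<eta>\<in>{0<..1}. S \<eta>) \<Longrightarrow> q \<in> (\<Union>\<eta>\<in>{0<..1}. S \<eta>) \<Longrightarrow> \<bar>g p - g q\<bar> \<le> D * dist p q"
    by (rule bounded_lipschitz_onE[OF assms(2)]) blast
  show ?thesis unfolding small_lipschitz_def
  proof (intro exI[of _ "2 * C * D"] conjI ballI)
    show "0 \<le> 2 * C * D" using C D by simp
    fix \<eta> :: real and p assume e: "\<eta> \<in> {0<..1}" and p: "p \<in> S \<eta>"
    have U: "q \<in> (\<Union>\<eta>\<in>{0<..1}. S \<eta>)" if "q \<in> S \<eta>" for q using e that by blast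
    have fp: "\<bar>f p\<bar> \<le> C * \<eta>" and gp: "\<bar>g p\<bar> \<le> D" using C(2)[of \<eta> p] D(2)[OF U[OF p]] e p by auto
    have "\<bar>f p * g p\<bar> \<le> (C * \<eta>) * D"
      unfolding abs_mult using fp gp C e by (intro mult_mono) auto
    moreover have "(C * \<eta>) * D \<ge> 0" using C D e by simp
    ultimately show "\<bar>f p * g p\<bar> \<le> 2 * C * D * \<eta>" by (simp add: mult_ac)
    fix q assume q: "q \<in> S \<eta>"
    have "\<bar>f p * g p - f q * g q\<bar> \<le> \<bar>f p\<bar> * \<bar>g p - g q\<bar> + \<bar>g q\<bar> * \<bar>f p - f q\<bar>"
      by (rule abs_diff_mult_le)
    also have "\<dots> \<le> (C * \<eta>) * (D * dist p q) + D * (C * \<eta> * dist p q)"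
      using fp C(1) C(3)[of \<eta> p q] D(1) D(2)[OF U[OF q]] D(3)[OF U[OF p] U[OF q]] p q e by (intro add_mono mult_mono) auto
    finally show "\<bar>f p * g p - f q * g q\<bar> \<le> 2 * C * D * \<eta> * dist p q" by (simp add: algebra_simps)
  qed
qed

lemma small_lipschitz_prod:
  fixes f g :: "'a::metric_space \<Rightarrow> real"
  assumes f: "\<And>\<eta> p. p \<in> S \<eta> \<Longrightarrow> \<bar>f p\<bar> \<le> \<eta>" "\<And>\<eta> p. p \<in> S \<eta> \<Longrightarrow> \<bar>g p\<bar> \<le> \<eta>"
    and l: "\<And>p q. \<bar>f p - f q\<bar> \<le> dist p q" "\<And>p q. \<bar>g p - g q\<bar> \<le> dist p q"
  shows "small_lipschitz S (\<lambda>p. f p * g p)"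
  unfolding small_lipschitz_def
proof (intro exI[of _ 2] conjI ballI)
  fix \<eta> :: real and p assume e: "\<eta> \<in> {0<..1}" and p: "p \<in> S \<eta>"
  have "\<bar>f p * g p\<bar> \<le> \<eta> * 1" unfolding abs_mult
    using f(1)[OF p] f(2)[OF p] e by (intro mult_mono) auto
  then show "\<bar>f p * g p\<bar> \<le> 2 * \<eta>" using e by simp
  fix q assume q: "q \<in> S \<eta>"
  have "\<bar>f p * g p - f q * g q\<bar> \<le> \<bar>f p\<bar> * \<bar>g p - g q\<bar> + \<bar>g q\<bar> * \<bar>f p - f q\<bar>"
    by (rule abs_diff_mult_le)
  also have "\<dots> \<le> \<eta> * dist p q + \<eta> * dist p q"
    using f(1)[OF p] f(2)[OF q] l e by (intro add_mono mult_mono) auto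
  finally show "\<bar>f p * g p - f q * g q\<bar> \<le> 2 * \<eta> * dist p q" by simp
qed simp

subsection \<open>A quadratic form for the linearised system\<close>

text \<open>The left-hand side is \<open>q' + 2\<nu> q\<close> for \<open>q = Y\<^sup>2 + 2\<beta> Y P + \<rho> P\<^sup>2\<close> along the linear system
  \<open>Y' = \<alpha> P - b Y\<close>, \<open>P' = k Y\<close>; the choice of \<open>\<rho>\<close> in the proof cancels its mixed term.\<close>
lemma quadratic_form_exists:
  fixes b k \<alpha> :: real
  assumes "b > 0" "k > 0"
  obtains \<beta> \<rho> \<nu> \<mu> where "\<nu> > 0" "\<mu> > 0"
   "\<And>Y P. 2*Y*(\<alpha>*P - b*Y) + 2*\<beta>*((\<alpha>*P - b*Y)*P + k*Y\<^sup>2) + 2*\<rho>*k*Y*P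
        + 2*\<nu>*(Y\<^sup>2 + 2*\<beta>*Y*P + \<rho>*P\<^sup>2) \<le> - \<mu> * (Y\<^sup>2 + P\<^sup>2)"
proof -
  note outer = that
  \<comment> \<open>With the mixed term cancelled, \<open>c1\<close> and \<open>c2\<close> say that
    the coefficients of Y^2 and of P^2 are negative.\<close>
  have main: thesis if nu: "\<nu> > 0" and c1: "-b + \<beta>*k + \<nu> < 0" and c2: "\<beta>*\<alpha> + \<nu>*((\<beta>*b - \<alpha> - 2*\<nu>*\<beta>)/k) < 0" for \<beta> \<nu>
  proof -
    define \<rho> where "\<rho> = (\<beta>*b - \<alpha> - 2*\<nu>*\<beta>)/k"
    define \<mu> where "\<mu> = min (2*(b - \<beta>*k - \<nu>)) (- 2*(\<beta>*\<alpha> + \<nu>*\<rho>))"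
    have mu: "\<mu> > 0" using c1 c2 unfolding \<mu>_def \<rho>_def by simp
    have "k * \<rho> = \<beta>*b - \<alpha> - 2*\<nu>*\<beta>" using \<open>k > 0\<close> by (simp add: \<rho>_def)
    then have z: "\<alpha> - \<beta>*b + k*\<rho> + 2*\<nu>*\<beta> = 0" by simp
    have "2*Y*(\<alpha>*P - b*Y) + 2*\<beta>*((\<alpha>*P - b*Y)*P + k*Y\<^sup>2) + 2*\<rho>*k*Y*P
        + 2*\<nu>*(Y\<^sup>2 + 2*\<beta>*Y*P + \<rho>*P\<^sup>2) \<le> - \<mu> * (Y\<^sup>2 + P\<^sup>2)" for Y P
    proof -
      have "2*Y*(\<alpha>*P - b*Y) + 2*\<beta>*((\<alpha>*P - b*Y)*P + k*Y\<^sup>2) + 2*\<rho>*k*Y*P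
          + 2*\<nu>*(Y\<^sup>2 + 2*\<beta>*Y*P + \<rho>*P\<^sup>2)
        = - (2*(b - \<beta>*k - \<nu>) * Y\<^sup>2) - (- 2*(\<beta>*\<alpha> + \<nu>*\<rho>)) * P\<^sup>2
          + 2*Y*P*(\<alpha> - \<beta>*b + k*\<rho> + 2*\<nu>*\<beta>)"
        by (simp add: algebra_simps power2_eq_square)
      moreover have "\<mu> * Y\<^sup>2 \<le> 2*(b - \<beta>*k - \<nu>) * Y\<^sup>2" "\<mu> * P\<^sup>2 \<le> (- 2*(\<beta>*\<alpha> + \<nu>*\<rho>)) * P\<^sup>2"
        unfolding \<mu>_def by (intro mult_right_mono min.cobounded1 min.cobounded2 zero_le_power2)+
      ultimately show ?thesis unfolding z by (simp add: distrib_left)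
    qed
    then show thesis using outer[OF nu mu] by blast
  qed
  show thesis
  proof (cases "\<alpha> \<ge> 0")
    case True
    show thesis
    \<comment> \<open>Here \<rho> = -(\<alpha> + b^2/2)/k is negative, so \<nu>\<rho> keeps the
      coefficient of P^2 negative even for \<alpha> = 0, where the linear system has the eigenvalue
      0.\<close>
    proof (rule main[of "b/4" "-b"])
      have "- b * \<alpha> + b/4 * ((- b*b - \<alpha> - 2*(b/4)*(-b))/k) = - (b * \<alpha>) - (b*\<alpha>/4 + b*b*b/8)/k"
        using \<open>k > 0\<close> by (simp add: field_simps)
      also have "\<dots> < 0"
      proof -
        have "b * \<alpha> \<ge> 0" "b * b * b > 0" using assms True by simp_all
        then have "(b*\<alpha>/4 + b*b*b/8)/k > 0" using \<open>k > 0\<close> by (intro divide_pos_pos) linarith+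
        then show ?thesis using \<open>b * \<alpha> \<ge> 0\<close> by linarith
      qed
      finally show "- b * \<alpha> + b/4 * ((- b*b - \<alpha> - 2*(b/4)*(-b))/k) < 0" .
      show "- b + - b * k + b/4 < 0"
        using mult_pos_pos[OF assms] assms by linarith
    qed (use assms in simp)
  next
    case False
    define n where "n = - \<alpha>"
    have n: "n > 0" using False by (simp add: n_def)
    \<comment> \<open>Both eigenvalues now have negative real part and \<rho> > 0, so \<nu> must be
      small: the second entry keeps \<nu>\<rho> below half of the good term b n / (2 k), and the
      first one gives -b + b/2 + \<nu> < 0.\<close>
    define \<nu> where "\<nu> = min (b/4) (b*n / (4*(b*b/(2*k) + n)))"
    have q: "b*b/(2*k) + n > 0" using assms n by (simp add: add_pos_pos)
    have nu: "\<nu> > 0" unfolding \<nu>_def min_less_iff_conj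
      by (intro conjI divide_pos_pos mult_pos_pos q) (use assms n in auto)
    have "\<nu> \<le> b*n / (4*(b*b/(2*k) + n))" by (simp add: \<nu>_def)
    then have "\<nu> * (4 * (b*b/(2*k) + n)) \<le> b*n" using q by (simp add: pos_le_divide_eq)
    then have "\<nu> * (b*b/(2*k) + n) \<le> b*n/4"
      unfolding mult.left_commute[of \<nu> 4] by linarith
    then have le: "\<nu> * (b*b/(2*k) + n) < b*n/2" using mult_pos_pos[OF \<open>b > 0\<close> n] by linarith
    show thesis
    proof (rule main[of \<nu> "b/(2*k)"])
      have "b/(2*k) * \<alpha> + \<nu>*((b/(2*k)*b - \<alpha> - 2*\<nu>*(b/(2*k)))/k) 
          = (\<nu> * (b*b/(2*k) + n) - b*n/2 - \<nu>*\<nu>*b/k) / k"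
        using \<open>k > 0\<close> by (simp add: n_def field_simps)
      also have "\<dots> < 0"
      proof (rule divide_neg_pos)
        have "\<nu>*\<nu>*b/k > 0" using assms nu by simp
        then show "\<nu> * (b*b/(2*k) + n) - b*n/2 - \<nu>*\<nu>*b/k < 0" using le by linarith
      qed fact
      finally show "b/(2*k) * \<alpha> + \<nu>*((b/(2*k)*b - \<alpha> - 2*\<nu>*(b/(2*k)))/k) < 0" .
      have "\<nu> \<le> b/4" unfolding \<nu>_def by (rule min.cobounded1)
      then show "- b + b / (2 * k) * k + \<nu> < 0" using assms by simp
    qed (use nu in auto)
  qed
qed

subsection \<open>The vector field\<close>

text \<open>On \<Sigma> both y and z have size at most 1. The side 2 leaves room, which later keeps
  an orbit from leaving the box through these faces.\<close>

definition state_box :: "real \<Rightarrow> real \<Rightarrow> state set" where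
  "state_box X B = {-X..X} \<times> {-2..2} \<times> {-2..2} \<times> {-B..B}"

lemma norm_state_le:
  "norm p \<le> \<bar>fst p\<bar> + \<bar>fst (snd p)\<bar> + \<bar>fst (snd (snd p))\<bar> + \<bar>snd (snd (snd p))\<bar>" for p :: state
proof -
  have "norm p \<le> norm (fst p) + norm (snd p)" for p :: "'x::real_normed_vector \<times> 'y::real_normed_vector"
    using norm_Pair_le[of "fst p" "snd p"] by simp
  from this[of p] this[of "snd p"] this[of "snd (snd p)"] show ?thesis by simp
qed

locale scalar_field =
  fixes \<gamma> :: real and V \<kappa> :: "real \<Rightarrow> real"
  assumes \<gamma>_pos: "0 < \<gamma>" and \<gamma>_less: "\<gamma> < 2"
    and V_pos: "\<And>t. V t > 0" and \<kappa>_pos: "\<And>t. \<kappa> t > 0"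
    and V_C3: "C3 V" and \<kappa>_C3: "C3 \<kappa>"
begin

text \<open>At x = y = 0, z = 1 the field is (0, \<open>A \<phi>\<close>, 0, 0), so the equilibria
  of this kind are the zeros of \<open>A\<close>. Up to a factor, \<open>A \<phi> * y\<close> is the
  derivative of \<open>ln (\<kappa> \<phi>)\<close> along an orbit.\<close>

definition A :: "real \<Rightarrow> real" where
  "A t = (4 - 3 * \<gamma>) / (2 * sqrt 6) * (deriv \<kappa> t / \<kappa> t)"

definition A' :: "real \<Rightarrow> real" where
  "A' t = (4 - 3 * \<gamma>) / (2 * sqrt 6) *
     ((deriv (deriv \<kappa>) t * \<kappa> t - deriv \<kappa> t * deriv \<kappa> t) / (\<kappa> t * \<kappa> t))"

lemma V_deriv: "(V has_real_derivative deriv V t) (at t)"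
  and V_deriv2: "(deriv V has_real_derivative deriv (deriv V) t) (at t)"
  and \<kappa>_deriv: "(\<kappa> has_real_derivative deriv \<kappa> t) (at t)"
  using V_C3 \<kappa>_C3 unfolding C3_def by blast+

lemma A_deriv: "(A has_real_derivative A' t) (at t)"
proof -
  have "(deriv \<kappa> has_real_derivative deriv (deriv \<kappa>) t) (at t)"
    using \<kappa>_C3 unfolding C3_def by blast
  then show ?thesis
    unfolding A_def[abs_def] A'_def
    using \<kappa>_deriv[of t] \<kappa>_pos[of t] by (intro DERIV_cmult DERIV_divide) auto
qed

lemma continuous_deriv:
  "continuous_on UNIV (deriv V)" "continuous_on UNIV (deriv (deriv V))" 
  "continuous_on UNIV (deriv \<kappa>)" "continuous_on UNIV A'"
proof -
  have *: "continuous_on UNIV (deriv f)" "continuous_on UNIV (deriv (deriv f))" if "C3 f" for f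
    using that unfolding C3_def by (auto intro!: DERIV_continuous_on)
  show "continuous_on UNIV (deriv V)" "continuous_on UNIV (deriv (deriv V))" "continuous_on UNIV (deriv \<kappa>)"
    using * V_C3 \<kappa>_C3 by blast+
  have "continuous_on UNIV \<kappa>" by (rule DERIV_continuous_on) (use \<kappa>_deriv in auto)
  then show "continuous_on UNIV A'"
    unfolding A'_def using *[OF \<kappa>_C3] \<kappa>_pos
    by (intro continuous_intros) (auto simp: less_imp_neq[THEN not_sym])
qed

lemma continuous_A: "continuous_on S A"
  by (rule DERIV_continuous_on) (use A_deriv has_field_derivative_at_within in blast)

lemma bounded_lipschitz_V: "bounded_lipschitz_on {-B..B} V"
  and bounded_lipschitz_V': "bounded_lipschitz_on {-B..B} (deriv V)"
  and bounded_lipschitz_A: "bounded_lipschitz_on {-B..B} A"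
  using bounded_lipschitz_on_C1[OF V_deriv] bounded_lipschitz_on_C1[OF V_deriv2]
    bounded_lipschitz_on_C1[OF A_deriv] continuous_deriv
  by blast+

lemma bounded_on_compact:
  fixes f :: "real \<Rightarrow> real"
  assumes "continuous_on {-B..B} f"
  obtains C where "C > 0" "\<And>t. \<bar>t\<bar> \<le> B \<Longrightarrow> \<bar>f t\<bar> \<le> C"
proof -
  have "bounded (f ` {-B..B})"
    by (intro compact_imp_bounded compact_continuous_image assms compact_Icc)
  then obtain C where "C > 0" "\<And>t. t \<in> {-B..B} \<Longrightarrow> \<bar>f t\<bar> \<le> C"
    unfolding bounded_pos by (metis imageI real_norm_def)
  then show thesis using that[of C] by (simp add: abs_le_iff)
qed

text \<open>On a compact range of \<phi> the potential stays away from 0, while the constraint gives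
  x^2 V \<le> 3.\<close>

lemma Sigma_x_bounded:
  obtains X where "\<And>p. p \<in> Sigma_state V \<Longrightarrow> \<bar>phi_of p\<bar> \<le> B \<Longrightarrow> fst p \<le> X"
proof -
  have "continuous_on {-B..B} (\<lambda>t. 1 / V t)"
    by (rule DERIV_continuous_on)
      (use V_pos V_deriv in \<open>force intro!: derivative_eq_intros intro: has_field_derivative_at_within simp: less_imp_neq[THEN not_sym]\<close>)
  then obtain C where C: "C > 0" "\<And>t. \<bar>t\<bar> \<le> B \<Longrightarrow> \<bar>1 / V t\<bar> \<le> C"
    using bounded_on_compact by blast
  have "fst p \<le> 3 * C + 1" if "p \<in> Sigma_state V" "\<bar>phi_of p\<bar> \<le> B" for p
  proof -
    obtain x y z \<phi> where p: "p = (x, y, z, \<phi>)" by (cases p) auto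
    have x: "x \<ge> 0" and s: "y\<^sup>2 + z\<^sup>2 + 1/3 * x\<^sup>2 * V \<phi> = 1" and ph: "\<bar>\<phi>\<bar> \<le> B"
      using that by (auto simp: Sigma_state_def phi_of_def p)
    have "1 / V \<phi> \<le> C" using C(2)[OF ph] by linarith
    then have "1 \<le> C * V \<phi>" using V_pos[of \<phi>] by (simp add: field_simps)
    then have "x\<^sup>2 * 1 \<le> x\<^sup>2 * (C * V \<phi>)" by (rule mult_left_mono) simp
    also have "\<dots> = C * (x\<^sup>2 * V \<phi>)" by simp
    also have "\<dots> \<le> C * 3"
      using s zero_le_power2[of y] zero_le_power2[of z] C by (intro mult_left_mono) linarith+
    finally have "x\<^sup>2 \<le> 3 * C" by simp
    moreover have "x \<le> x\<^sup>2 + 1"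
      using zero_le_power2[of "x - 1"] x by (simp add: power2_eq_square algebra_simps)
    ultimately show ?thesis by (simp add: p)
  qed
  then show thesis by (rule that)
qed

lemma bounded_lipschitz_coordinates:
  "bounded_lipschitz_on (state_box X B) fst"
  "bounded_lipschitz_on (state_box X B) (\<lambda>p. fst (snd p))"
  "bounded_lipschitz_on (state_box X B) (\<lambda>p. fst (snd (snd p)))"
  "bounded_lipschitz_on {-B..B} h \<Longrightarrow> bounded_lipschitz_on (state_box X B) (\<lambda>p. h (snd (snd (snd p))))"
proof -
  have d: "dist (fst p) (fst q) \<le> dist p q" "dist (fst (snd p)) (fst (snd q)) \<le> dist p q"
    "dist (fst (snd (snd p))) (fst (snd (snd q))) \<le> dist p q"
    "dist (snd (snd (snd p))) (snd (snd (snd q))) \<le> dist p q" for p q :: state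
    by (meson dist_fst_le dist_snd_le order_trans)+
  show "bounded_lipschitz_on (state_box X B) fst"
    by (rule bounded_lipschitz_onI[of _ _ X 1]) (use d in \<open>auto simp: state_box_def dist_real_def\<close>)
  show "bounded_lipschitz_on (state_box X B) (\<lambda>p. fst (snd p))"
    by (rule bounded_lipschitz_onI[of _ _ 2 1]) (use d in \<open>auto simp: state_box_def dist_real_def\<close>)
  show "bounded_lipschitz_on (state_box X B) (\<lambda>p. fst (snd (snd p)))"
    by (rule bounded_lipschitz_onI[of _ _ 2 1]) (use d in \<open>auto simp: state_box_def dist_real_def\<close>)
  show "bounded_lipschitz_on (state_box X B) (\<lambda>p. h (snd (snd (snd p))))"
    if "bounded_lipschitz_on {-B..B} h"
    by (rule bounded_lipschitz_on_compose[OF that]) (use d in \<open>auto simp: state_box_def\<close>)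
qed

lemma ode_field_eq:
  "ode_field \<gamma> V \<kappa> (x, y, z, \<phi>) =
    (x * (y^2 + \<gamma>/2 * z^2),
     y^3 + 1/2 * (\<gamma> * z^2 - 2) * y - x^2 * deriv V \<phi> / (3 * sqrt 6) + A \<phi> * z^2,
     z * (y^2 + (z^2 - 1) * (\<gamma>/2) - A \<phi> * y),
     sqrt (2/3) * y)"
  by (simp add: ode_field_def A_def field_simps)

lemma ode_field_lipschitz:
  obtains L where "L \<ge> 0"
    "\<And>p. p \<in> state_box X B \<Longrightarrow> norm (ode_field \<gamma> V \<kappa> p) \<le> L"
    "\<And>p q. p \<in> state_box X B \<Longrightarrow> q \<in> state_box X B \<Longrightarrow>
       norm (ode_field \<gamma> V \<kappa> p - ode_field \<gamma> V \<kappa> q) \<le> L * norm (p - q)"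
proof -
  let ?F = "ode_field \<gamma> V \<kappa>" and ?S = "state_box X B"
  note intros = bounded_lipschitz_coordinates bounded_lipschitz_on_const bounded_lipschitz_on_add
    bounded_lipschitz_on_mult bounded_lipschitz_on_diff bounded_lipschitz_on_power
    bounded_lipschitz_on_divide_const bounded_lipschitz_V' bounded_lipschitz_A
  have F: "?F p = (fst p * ((fst (snd p))^2 + \<gamma>/2 * (fst (snd (snd p)))^2),
     (fst (snd p))^3 + 1/2 * (\<gamma> * (fst (snd (snd p)))^2 - 2) * fst (snd p)
       - (fst p)^2 * deriv V (snd (snd (snd p))) / (3 * sqrt 6) + A (snd (snd (snd p))) * (fst (snd (snd p)))^2,
     fst (snd (snd p)) * ((fst (snd p))^2 + ((fst (snd (snd p)))^2 - 1) * (\<gamma>/2) - A (snd (snd (snd p))) * fst (snd p)),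
     sqrt (2/3) * fst (snd p))" for p
    using ode_field_eq[of "fst p" "fst (snd p)" "fst (snd (snd p))" "snd (snd (snd p))"] by simp
  have "bounded_lipschitz_on ?S (\<lambda>p. fst (?F p))"
    unfolding F fst_conv snd_conv by (intro intros)
  then obtain a where a: "a \<ge> 0" "\<And>p. p \<in> ?S \<Longrightarrow> \<bar>fst (?F p)\<bar> \<le> a"
    "\<And>p q. p \<in> ?S \<Longrightarrow> q \<in> ?S \<Longrightarrow> \<bar>fst (?F p) - fst (?F q)\<bar> \<le> a * dist p q"
    by (rule bounded_lipschitz_onE) blast
  have "bounded_lipschitz_on ?S (\<lambda>p. fst (snd (?F p)))"
    unfolding F fst_conv snd_conv by (intro intros)
  then obtain b where b: "b \<ge> 0" "\<And>p. p \<in> ?S \<Longrightarrow> \<bar>fst (snd (?F p))\<bar> \<le> b"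
    "\<And>p q. p \<in> ?S \<Longrightarrow> q \<in> ?S \<Longrightarrow> \<bar>fst (snd (?F p)) - fst (snd (?F q))\<bar> \<le> b * dist p q"
    by (rule bounded_lipschitz_onE) blast
  have "bounded_lipschitz_on ?S (\<lambda>p. fst (snd (snd (?F p))))"
    unfolding F fst_conv snd_conv by (intro intros)
  then obtain c where c: "c \<ge> 0" "\<And>p. p \<in> ?S \<Longrightarrow> \<bar>fst (snd (snd (?F p)))\<bar> \<le> c"
    "\<And>p q. p \<in> ?S \<Longrightarrow> q \<in> ?S \<Longrightarrow> \<bar>fst (snd (snd (?F p))) - fst (snd (snd (?F q)))\<bar> \<le> c * dist p q"
    by (rule bounded_lipschitz_onE) blast
  have "bounded_lipschitz_on ?S (\<lambda>p. snd (snd (snd (?F p))))"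
    unfolding F fst_conv snd_conv by (intro intros)
  then obtain d where d: "d \<ge> 0" "\<And>p. p \<in> ?S \<Longrightarrow> \<bar>snd (snd (snd (?F p)))\<bar> \<le> d"
    "\<And>p q. p \<in> ?S \<Longrightarrow> q \<in> ?S \<Longrightarrow> \<bar>snd (snd (snd (?F p))) - snd (snd (snd (?F q)))\<bar> \<le> d * dist p q"
    by (rule bounded_lipschitz_onE) blast
  note n = norm_state_le
  show thesis
  proof (rule that[of "a + b + c + d"])
    fix p assume p: "p \<in> ?S"
    show "norm (?F p) \<le> a + b + c + d"
      using n[of "?F p"] a(2)[OF p] b(2)[OF p] c(2)[OF p] d(2)[OF p] by linarith
    fix q assume q: "q \<in> ?S"
    show "norm (?F p - ?F q) \<le> (a + b + c + d) * norm (p - q)"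
      using n[of "?F p - ?F q"] a(3)[OF p q] b(3)[OF p q] c(3)[OF p q] d(3)[OF p q]
      by (simp add: dist_norm distrib_right)
  qed (use a b c d in simp)
qed

end

subsection \<open>Asymptotics of bounded past orbits\<close>

lemma has_derivative_components:
  fixes u :: "real \<Rightarrow> state"
  assumes d: "(u has_vector_derivative (a, b, c, e)) F"
  shows "((\<lambda>t. fst (u t)) has_real_derivative a) F"
    "((\<lambda>t. fst (snd (u t))) has_real_derivative b) F"
    "((\<lambda>t. fst (snd (snd (u t)))) has_real_derivative c) F"
    "((\<lambda>t. snd (snd (snd (u t)))) has_real_derivative e) F"
proof -
  have snd: "((\<lambda>t. snd (f t)) has_vector_derivative snd f') F"
    and fst: "((\<lambda>t. fst (f t)) has_vector_derivative fst f') F"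
    if "(f has_vector_derivative f') F"
    for f :: "real \<Rightarrow> 'a::real_normed_vector \<times> 'b::real_normed_vector" and f'
    using bounded_linear.has_vector_derivative[OF bounded_linear_snd that]
      bounded_linear.has_vector_derivative[OF bounded_linear_fst that] by auto
  show "((\<lambda>t. fst (u t)) has_real_derivative a) F"
    "((\<lambda>t. fst (snd (u t))) has_real_derivative b) F"
    "((\<lambda>t. fst (snd (snd (u t)))) has_real_derivative c) F"
    "((\<lambda>t. snd (snd (snd (u t)))) has_real_derivative e) F"
    unfolding has_real_derivative_iff_has_vector_derivative
    using fst[OF d] fst[OF snd[OF d]] fst[OF snd[OF snd[OF d]]] snd[OF snd[OF snd[OF d]]]
    by simp_all
qed

text \<open>\<open>B\<close> is a parameter rather than the least bound of the orbit, so that two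
  orbits can be compared under a common \<open>B\<close>. At time 0 the derivative is
  one-sided.\<close>

locale bounded_past_orbit = scalar_field +
  fixes B :: real and u :: "real \<Rightarrow> state"
  assumes u_deriv: "\<And>t. t \<le> 0 \<Longrightarrow> (u has_vector_derivative ode_field \<gamma> V \<kappa> (u t)) (at t within {..0})"
    and u_Sigma: "\<And>t. t \<le> 0 \<Longrightarrow> u t \<in> Sigma_state V"
    and u_bounded: "\<And>t. t \<le> 0 \<Longrightarrow> \<bar>phi_of (u t)\<bar> \<le> B"
begin

definition x where "x t = fst (u t)"
definition y where "y t = fst (snd (u t))"
definition z where "z t = fst (snd (snd (u t)))"
definition \<phi> where "\<phi> t = snd (snd (snd (u t)))"
definition w where "w t = (x t)\<^sup>2 * V (\<phi> t) / 3"

lemma u_eq: "u t = (x t, y t, z t, \<phi> t)"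
  by (simp add: x_def y_def z_def \<phi>_def)

definition x' where "x' t = x t * ((y t)\<^sup>2 + \<gamma>/2 * (z t)\<^sup>2)"
definition y' where "y' t = y t ^ 3 + 1/2 * (\<gamma> * (z t)\<^sup>2 - 2) * y t
  - (x t)\<^sup>2 * deriv V (\<phi> t) / (3 * sqrt 6) + A (\<phi> t) * (z t)\<^sup>2"
definition z' where "z' t = z t * ((y t)\<^sup>2 + ((z t)\<^sup>2 - 1) * (\<gamma>/2) - A (\<phi> t) * y t)"

lemma field_u: "ode_field \<gamma> V \<kappa> (u t) = (x' t, y' t, z' t, sqrt (2/3) * y t)"
  by (simp add: u_eq ode_field_eq x'_def y'_def z'_def)

lemma derivs_within:
  assumes "t \<le> 0"
  shows "(x has_real_derivative x' t) (at t within {..0})"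
    "(y has_real_derivative y' t) (at t within {..0})"
    "(z has_real_derivative z' t) (at t within {..0})"
    "(\<phi> has_real_derivative sqrt (2/3) * y t) (at t within {..0})"
proof -
  note d = u_deriv[OF assms, unfolded field_u]
  show "(x has_real_derivative x' t) (at t within {..0})"
    "(y has_real_derivative y' t) (at t within {..0})"
    "(z has_real_derivative z' t) (at t within {..0})"
    "(\<phi> has_real_derivative sqrt (2/3) * y t) (at t within {..0})"
    using has_derivative_components[OF d]
    unfolding x_def[abs_def] y_def[abs_def] z_def[abs_def] \<phi>_def[abs_def] by auto
qed

lemma derivs_at:
  assumes "t < 0"
  shows "(x has_real_derivative x' t) (at t)"
    "(y has_real_derivative y' t) (at t)"
    "(z has_real_derivative z' t) (at t)"
    "(\<phi> has_real_derivative sqrt (2/3) * y t) (at t)"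
proof -
  have "at t within {..0} = at t"
    by (rule at_within_open_subset[of _ "{..<0}"]) (use assms in auto)
  then show "(x has_real_derivative x' t) (at t)"
    "(y has_real_derivative y' t) (at t)"
    "(z has_real_derivative z' t) (at t)"
    "(\<phi> has_real_derivative sqrt (2/3) * y t) (at t)"
    using derivs_within[of t] assms by auto
qed

lemma continuous_components:
  assumes "S \<subseteq> {..0}"
  shows "continuous_on S x" "continuous_on S y" "continuous_on S z" "continuous_on S \<phi>"
  by (rule continuous_on_subset[OF DERIV_continuous_on assms], rule derivs_within, simp)+

lemma components:
  assumes "t \<le> 0"
  shows "x t \<ge> 0" "z t \<ge> 0" "(y t)\<^sup>2 + (z t)\<^sup>2 + w t = 1" "\<bar>\<phi> t\<bar> \<le> B"
proof -
  have "(x t, y t, z t, \<phi> t) \<in> Sigma_state V"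
    using u_Sigma[OF assms] by (simp only: u_eq[symmetric])
  then have "x t \<ge> 0 \<and> z t \<ge> 0 \<and> (y t)\<^sup>2 + (z t)\<^sup>2 + 1/3 * (x t)\<^sup>2 * V (\<phi> t) = 1"
    unfolding Sigma_state_def mem_Collect_eq prod.case .
  then show "x t \<ge> 0" "z t \<ge> 0" "(y t)\<^sup>2 + (z t)\<^sup>2 + w t = 1" unfolding w_def by simp_all
  show "\<bar>\<phi> t\<bar> \<le> B" using u_bounded[OF assms] by (simp add: phi_of_def \<phi>_def)
qed

lemma w_nonneg: "w t \<ge> 0"
  using V_pos[of "\<phi> t"] by (simp add: w_def)

lemma yz_bounded:
  assumes "t \<le> 0" shows "\<bar>y t\<bar> \<le> 1" "\<bar>z t\<bar> \<le> 1"
proof -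
  have "(y t)\<^sup>2 \<le> 1" "(z t)\<^sup>2 \<le> 1"
    using components(3)[OF assms] w_nonneg[of t] zero_le_power2[of "y t"] zero_le_power2[of "z t"]
    by linarith+
  then show "\<bar>y t\<bar> \<le> 1" "\<bar>z t\<bar> \<le> 1" by (simp_all add: abs_square_le_1)
qed

lemma u_in_box:
  assumes X: "\<And>p. p \<in> Sigma_state V \<Longrightarrow> \<bar>phi_of p\<bar> \<le> B \<Longrightarrow> fst p \<le> X" and t: "t \<le> 0"
  shows "u t \<in> state_box X B"
proof -
  have "x t \<le> X" using X[OF u_Sigma[OF t] u_bounded[OF t]] by (simp add: x_def)
  then show ?thesis using components[OF t] yz_bounded[OF t]
    by (subst u_eq) (auto simp: state_box_def)
qed

lemma derivs_bounded:
  obtains M where "M \<ge> 0" "\<And>t. t \<le> 0 \<Longrightarrow> \<bar>y' t\<bar> \<le> M" "\<And>t. t \<le> 0 \<Longrightarrow> \<bar>z' t\<bar> \<le> M"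
proof -
  obtain X where "\<And>p. p \<in> Sigma_state V \<Longrightarrow> \<bar>phi_of p\<bar> \<le> B \<Longrightarrow> fst p \<le> X"
    using Sigma_x_bounded by blast
  then have X: "u t \<in> state_box X B" if "t \<le> 0" for t using u_in_box that by blast
  obtain L where L: "L \<ge> 0" "\<And>p. p \<in> state_box X B \<Longrightarrow> norm (ode_field \<gamma> V \<kappa> p) \<le> L"
    by (rule ode_field_lipschitz[of X B]) blast
  have "\<bar>y' t\<bar> \<le> L" "\<bar>z' t\<bar> \<le> L" if "t \<le> 0" for t
  proof -
    have n: "norm (x' t, y' t, z' t, sqrt (2/3) * y t) \<le> L"
      using L(2)[OF X[OF that]] by (simp only: field_u)
    have "norm (y' t, z' t, sqrt (2/3) * y t) \<le> L"
      using norm_snd_le n by (rule order_trans)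
    then show "\<bar>y' t\<bar> \<le> L" using norm_fst_le[of "y' t"] by (metis order_trans real_norm_def)
    have "norm (z' t, sqrt (2/3) * y t) \<le> L"
      using norm_snd_le \<open>norm (y' t, z' t, sqrt (2/3) * y t) \<le> L\<close> by (rule order_trans)
    then show "\<bar>z' t\<bar> \<le> L" using norm_fst_le[of "z' t"] by (metis order_trans real_norm_def)
  qed
  then show thesis using that L(1) by blast
qed

lemma z_pos:
  assumes "z 0 > 0" "t \<le> 0" shows "z t > 0"
proof -
  have c: "continuous_on {t..0} (\<lambda>t. (y t)\<^sup>2 + ((z t)\<^sup>2 - 1) * (\<gamma>/2) - A (\<phi> t) * y t)"
    by (intro continuous_intros continuous_components continuous_on_compose2[OF continuous_A[of UNIV]]) auto
  have d: "(z has_real_derivative z s * ((y s)\<^sup>2 + ((z s)\<^sup>2 - 1) * (\<gamma>/2) - A (\<phi> s) * y s)) (at s within {t..0})"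
    if "t \<le> s" "s \<le> 0" for s
    using derivs_within(3)[of s] that unfolding z'_def by (auto intro: DERIV_subset)
  obtain e where "e > 0" "z t = z 0 * e"
    by (rule linear_ode_factor[OF assms(2) d c])
  then show ?thesis using assms by simp
qed

lemma x_mono:
  assumes "s \<le> t" "t < 0" shows "x s \<le> x t"
proof (rule DERIV_nonneg_imp_nondecreasing[OF assms(1)])
  fix r assume "s \<le> r" "r \<le> t"
  then show "\<exists>d. (x has_real_derivative d) (at r) \<and> 0 \<le> d"
    using derivs_at(1)[of r] components(1)[of r] \<gamma>_pos assms
    by (intro exI[of _ "x' r"]) (auto simp: x'_def)
qed

section \<open>Limits of x, y, z and \<open>A \<phi>\<close> in the past\<close>

lemma eventually_neg: "eventually (\<lambda>t. t < (0::real)) at_bot"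
  unfolding eventually_at_bot_linorder by (rule exI[of _ "-1"]) auto

lemma A_phi_bounded:
  obtains C where "C > 0" "\<And>t. t \<le> 0 \<Longrightarrow> \<bar>A (\<phi> t)\<bar> \<le> C"
proof -
  obtain C where "C > 0" "\<And>t. \<bar>t\<bar> \<le> B \<Longrightarrow> \<bar>A t\<bar> \<le> C"
    by (rule bounded_on_compact[OF continuous_A]) blast
  then show thesis using that components(4) by blast
qed

lemma A_phi_y_null:
  assumes "(y \<longlongrightarrow> 0) at_bot"
  shows "((\<lambda>t. A (\<phi> t) * y t) \<longlongrightarrow> 0) at_bot"
proof -
  obtain C where C: "C > 0" "\<And>t. t \<le> 0 \<Longrightarrow> \<bar>A (\<phi> t)\<bar> \<le> C" using A_phi_bounded by blast
  have "\<forall>\<^sub>F t in at_bot. norm (A (\<phi> t) * y t) \<le> C * \<bar>y t\<bar>"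
    using eventually_neg by eventually_elim (use C in \<open>auto simp: abs_mult intro!: mult_right_mono\<close>)
  moreover have "((\<lambda>t. C * \<bar>y t\<bar>) \<longlongrightarrow> 0) at_bot"
    using tendsto_mult_right_zero[OF tendsto_rabs_zero[OF assms]] by simp
  ultimately show ?thesis by (rule Lim_null_comparison)
qed

lemma sq_null: "((\<lambda>t. (f t)\<^sup>2) \<longlongrightarrow> 0) F \<Longrightarrow> (f \<longlongrightarrow> 0) F" for f :: "real \<Rightarrow> real"
  using tendsto_real_sqrt[of "\<lambda>t. (f t)\<^sup>2" 0 F] by (simp add: tendsto_rabs_zero_iff)

text \<open>If \<open>x\<close> had a positive limit, then \<open>y\<close> and \<open>z\<close> would tend to 0; but near \<open>y = z = 0\<close> the function
  \<open>z\<close> decreases, so it cannot tend to 0 in the past.\<close>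
lemma x_null:
  assumes z0: "z 0 > 0"
  shows "(x \<longlongrightarrow> 0) at_bot"
proof (cases "\<exists>c>0. \<forall>t<0. c \<le> x t")
  case True
  then obtain c where c: "c > 0" "\<And>t. t < 0 \<Longrightarrow> c \<le> x t" by blast
  obtain M where M: "M \<ge> 0" "\<And>t. t \<le> 0 \<Longrightarrow> \<bar>y' t\<bar> \<le> M" "\<And>t. t \<le> 0 \<Longrightarrow> \<bar>z' t\<bar> \<le> M"
    using derivs_bounded by blast
  define f where "f t = (y t)\<^sup>2 + \<gamma>/2 * (z t)\<^sup>2" for t
  \<comment> \<open>The derivative of ln x is exactly \<open>f\<close>, and x \<ge> c bounds ln x
    from below.\<close>
  have f0: "(f \<longlongrightarrow> 0) at_bot"
  proof (rule barbalat[of "-1" "\<lambda>t. ln (x t)" f])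
    fix t :: real assume t: "t \<le> -1"
    show "((\<lambda>t. ln (x t)) has_real_derivative f t) (at t)"
      using derivs_at(1)[of t] c(2)[of t] c(1) t unfolding x'_def f_def
      by (auto intro!: derivative_eq_intros)
    show "(f has_real_derivative (2 * y t * y' t + \<gamma> * z t * z' t)) (at t)"
      unfolding f_def using derivs_at[of t] t
      by (auto intro!: derivative_eq_intros)
    have "\<bar>y t * y' t\<bar> \<le> 1 * M" "\<bar>z t * z' t\<bar> \<le> 1 * M"
      unfolding abs_mult using yz_bounded[of t] M(2,3)[of t] t by (intro mult_mono; simp)+
    then have "\<bar>2 * (y t * y' t)\<bar> \<le> 2 * M" "\<bar>\<gamma> * (z t * z' t)\<bar> \<le> 2 * M"
      using \<gamma>_pos \<gamma>_less mult_mono[of \<gamma> 2 "\<bar>z t * z' t\<bar>" M] by (auto simp: abs_mult)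
    then show "\<bar>2 * y t * y' t + \<gamma> * z t * z' t\<bar> \<le> 4 * M" by (simp add: mult.assoc)
    show "ln c \<le> ln (x t)" using c(2)[of t] c(1) t by simp
  qed (use \<gamma>_pos in \<open>auto simp: f_def\<close>)
  have "((\<lambda>t. (y t)\<^sup>2) \<longlongrightarrow> 0) at_bot"
    by (rule Lim_null_comparison[OF _ f0]) (use \<gamma>_pos in \<open>auto simp: f_def\<close>)
  then have y0: "(y \<longlongrightarrow> 0) at_bot" by (rule sq_null)
  have "((\<lambda>t. (z t)\<^sup>2) \<longlongrightarrow> 0) at_bot"
  proof (rule Lim_null_comparison)
    show "((\<lambda>t. 2 / \<gamma> * f t) \<longlongrightarrow> 0) at_bot" by (rule tendsto_mult_right_zero[OF f0])
  qed (use \<gamma>_pos in \<open>auto simp: f_def field_simps\<close>)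
  then have zz: "(z \<longlongrightarrow> 0) at_bot" by (rule sq_null)
  have "((\<lambda>t. (y t)\<^sup>2 + ((z t)\<^sup>2 - 1) * (\<gamma>/2) - A (\<phi> t) * y t) \<longlongrightarrow> 0\<^sup>2 + (0\<^sup>2 - 1) * (\<gamma>/2) - 0) at_bot"
    by (intro tendsto_intros y0 zz A_phi_y_null)
  then have "\<forall>\<^sub>F t in at_bot. (y t)\<^sup>2 + ((z t)\<^sup>2 - 1) * (\<gamma>/2) - A (\<phi> t) * y t < 0"
    by (rule order_tendstoD) (use \<gamma>_pos in simp)
  then have "\<forall>\<^sub>F t in at_bot. t < 0 \<and> (y t)\<^sup>2 + ((z t)\<^sup>2 - 1) * (\<gamma>/2) - A (\<phi> t) * y t < 0"
    using eventually_neg by eventually_elim simp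
  then obtain T where T: "\<And>t. t \<le> T \<Longrightarrow> t < 0"
    "\<And>t. t \<le> T \<Longrightarrow> (y t)\<^sup>2 + ((z t)\<^sup>2 - 1) * (\<gamma>/2) - A (\<phi> t) * y t < 0"
    unfolding eventually_at_bot_linorder by blast
  have "z T \<le> z t" if t: "t \<le> T" for t
  proof (rule DERIV_nonpos_imp_nonincreasing[OF t])
    fix s assume s: "t \<le> s" "s \<le> T"
    have "z' s \<le> 0" unfolding z'_def
      using T(2)[OF s(2)] components(2)[of s] T(1)[OF s(2)] by (intro mult_nonneg_nonpos) auto
    then show "\<exists>d. (z has_real_derivative d) (at s) \<and> d \<le> 0"
      using derivs_at(3)[OF T(1)[OF s(2)]] by blast
  qed
  then have "\<forall>\<^sub>F t in at_bot. z T \<le> z t" unfolding eventually_at_bot_linorder by blast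
  then have "z T \<le> 0" using zz by (intro tendsto_lowerbound) auto
  moreover have "z T > 0" using z_pos[OF z0, of T] T(1)[of T] by simp
  ultimately show ?thesis by simp
next
  case False
  show ?thesis
  proof (rule tendstoI)
    fix e :: real assume "e > 0"
    then obtain t0 where t0: "t0 < 0" "x t0 < e" using False by (auto simp: not_le)
    have "dist (x t) 0 < e" if "t \<le> t0" for t
      using x_mono[OF that t0(1)] components(1)[of t] t0 that by simp
    then show "\<forall>\<^sub>F t in at_bot. dist (x t) 0 < e"
      unfolding eventually_at_bot_linorder by blast
  qed
qed


lemma w_null:
  assumes "z 0 > 0"
  shows "(w \<longlongrightarrow> 0) at_bot"
proof -
  have "continuous_on {-B..B} V" by (rule DERIV_continuous_on) (use V_deriv has_field_derivative_at_within in blast)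
  then obtain C where C: "C > 0" "\<And>t. \<bar>t\<bar> \<le> B \<Longrightarrow> \<bar>V t\<bar> \<le> C"
    by (rule bounded_on_compact) blast
  have x2: "((\<lambda>t. (x t)\<^sup>2) \<longlongrightarrow> 0\<^sup>2) at_bot" by (intro tendsto_intros x_null assms)
  show ?thesis
  proof (rule Lim_null_comparison)
    show "((\<lambda>t. C / 3 * (x t)\<^sup>2) \<longlongrightarrow> 0) at_bot" using x2 by (intro tendsto_mult_right_zero) simp
    show "\<forall>\<^sub>F t in at_bot. norm (w t) \<le> C / 3 * (x t)\<^sup>2"
      using eventually_neg
    proof eventually_elim
      case (elim t)
      then have "V (\<phi> t) \<le> C" using C(2)[of "\<phi> t"] components(4)[of t] by auto
      then have "(x t)\<^sup>2 * V (\<phi> t) \<le> (x t)\<^sup>2 * C" by (rule mult_left_mono) simp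
      then show ?case using w_nonneg[of t] by (simp add: w_def mult.commute)
    qed
  qed
qed

text \<open>Up to the integrable term \<open>\<gamma> w / 2\<close>, which the multiple of \<open>x\<^sup>2\<close> absorbs, the function
  \<open>ln z + a ln \<kappa>\<close> increases at rate \<open>(1 - \<gamma>/2) y\<^sup>2\<close>. If it were unbounded below, then \<open>z\<close> would
  tend to 0 and \<open>\<bar>y\<bar>\<close> would stay away from 0, so that \<open>\<phi>\<close> would be unbounded.\<close>
lemma y_null:
  assumes z0: "z 0 > 0"
  shows "(y \<longlongrightarrow> 0) at_bot"
proof -
  define s where "s = sqrt (2/3)"
  have s: "s > 0" by (simp add: s_def)
  define b where "b = 1 - \<gamma>/2"
  have b: "b > 0" "b \<le> 1" using \<gamma>_less \<gamma>_pos by (auto simp: b_def)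
  \<comment> \<open>With this factor the derivative of \<open>a * ln (\<kappa> (\<phi> t))\<close>
    is \<open>A (\<phi> t) * y t\<close>, which cancels the term of indefinite sign in (ln
    z)'.\<close>
  define a where "a = (4 - 3 * \<gamma>) / (2 * sqrt 6) / s"
  have "continuous_on {-B..B} V" by (rule DERIV_continuous_on) (use V_deriv has_field_derivative_at_within in blast)
  then obtain C where C: "C > 0" "\<And>t. \<bar>t\<bar> \<le> B \<Longrightarrow> \<bar>V t\<bar> \<le> C"
    by (rule bounded_on_compact) blast
  have "continuous_on {-B..B} (\<lambda>t. ln (\<kappa> t))"
  proof (rule DERIV_continuous_on)
    show "((\<lambda>t. ln (\<kappa> t)) has_real_derivative deriv \<kappa> t / \<kappa> t) (at t within {-B..B})" for t
      using DERIV_chain2[OF DERIV_ln[OF \<kappa>_pos] \<kappa>_deriv, of t] 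
      by (auto intro: has_field_derivative_at_within simp: field_simps)
  qed
  then obtain D where D: "D > 0" "\<And>t. \<bar>t\<bar> \<le> B \<Longrightarrow> \<bar>ln (\<kappa> t)\<bar> \<le> D"
    by (rule bounded_on_compact) blast
  define E where "E t = ln (z t) + a * ln (\<kappa> (\<phi> t)) + C/3 * (x t)\<^sup>2" for t
  define E' where "E' t = ((y t)\<^sup>2 + ((z t)\<^sup>2 - 1) * (\<gamma>/2) - A (\<phi> t) * y t)
     + a * (deriv \<kappa> (\<phi> t) / \<kappa> (\<phi> t) * (s * y t)) + C/3 * (2 * x t * x' t)" for t
  have zp: "z t > 0" if "t < 0" for t using z_pos[OF z0, of t] that by simp
  have Ed: "(E has_real_derivative E' t) (at t)" if t: "t < 0" for t
  proof -
    have 1: "((\<lambda>t. ln (z t)) has_real_derivative ((y t)\<^sup>2 + ((z t)\<^sup>2 - 1) * (\<gamma>/2) - A (\<phi> t) * y t)) (at t)"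
    proof -
      have "inverse (z t) * z' t = (y t)\<^sup>2 + ((z t)\<^sup>2 - 1) * (\<gamma>/2) - A (\<phi> t) * y t"
        using zp[OF t] by (simp add: z'_def)
      then show ?thesis using DERIV_chain2[OF DERIV_ln[OF zp[OF t]] derivs_at(3)[OF t]] by simp
    qed
    have "((\<lambda>t. \<kappa> (\<phi> t)) has_real_derivative deriv \<kappa> (\<phi> t) * (s * y t)) (at t)"
      unfolding s_def by (rule DERIV_chain2[OF \<kappa>_deriv derivs_at(4)[OF t]])
    from DERIV_chain2[where f = ln and g = "\<lambda>t. \<kappa> (\<phi> t)" and x = t, OF DERIV_ln[OF \<kappa>_pos] this]
    have 2: "((\<lambda>t. ln (\<kappa> (\<phi> t))) has_real_derivative deriv \<kappa> (\<phi> t) / \<kappa> (\<phi> t) * (s * y t)) (at t)"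
      by (simp add: divide_inverse mult_ac)
    have 3: "((\<lambda>t. (x t)\<^sup>2) has_real_derivative 2 * x t * x' t) (at t)"
      using DERIV_power[OF derivs_at(1)[OF t], of 2] by (simp add: mult_ac)
    show ?thesis unfolding E_def E'_def
      by (intro DERIV_add DERIV_cmult 1 2 3)
  qed
  have E': "E' t = b * (y t)\<^sup>2 - \<gamma>/2 * w t + C/3 * (2 * x t * x' t)" if "t < 0" for t
  proof -
    have 1: "a * (deriv \<kappa> (\<phi> t) / \<kappa> (\<phi> t) * (s * y t)) = A (\<phi> t) * y t"
      using s by (simp add: a_def A_def)
    have 2: "(z t)\<^sup>2 - 1 = - ((y t)\<^sup>2 + w t)" using components(3)[of t] that by linarith
    show ?thesis unfolding E'_def 1 2 b_def by (simp add: algebra_simps)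
  qed
  have "\<forall>\<^sub>F t in at_bot. t < 0 \<and> w t < 1/4"
    using eventually_neg order_tendstoD(2)[OF w_null[OF z0], of "1/4"] by (simp add: eventually_conj_iff)
  then obtain T where T: "\<And>t. t \<le> T \<Longrightarrow> t < 0" "\<And>t. t \<le> T \<Longrightarrow> w t < 1/4"
    unfolding eventually_at_bot_linorder by blast
  have El: "E' t \<ge> b * (y t)\<^sup>2" if t: "t \<le> T" for t
  proof -
    note t0 = T(1)[OF t]
    have "\<gamma>/2 * (y t)\<^sup>2 \<le> 1 * (y t)\<^sup>2" using \<gamma>_less by (intro mult_right_mono) auto
    then have "\<gamma>/2 * ((y t)\<^sup>2 + (z t)\<^sup>2) \<le> (y t)\<^sup>2 + \<gamma>/2 * (z t)\<^sup>2" by (simp add: distrib_left)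
    moreover have "\<gamma>/2 * (1/2) \<le> \<gamma>/2 * ((y t)\<^sup>2 + (z t)\<^sup>2)"
      using components(3)[of t] t0 T(2)[OF t] \<gamma>_pos by (intro mult_left_mono) auto
    \<comment> \<open>The logarithmic growth rate of x is at least \<gamma>/4 once w < 1/4. Hence
      the derivative of C/3 x^2 dominates \<gamma> w / 2, as w \<le> C x^2 / 3.\<close>
    ultimately have g: "\<gamma>/4 \<le> (y t)\<^sup>2 + \<gamma>/2 * (z t)\<^sup>2" by linarith
    have "V (\<phi> t) \<le> C" using C(2)[of "\<phi> t"] components(4)[of t] t0 by auto
    then have "(x t)\<^sup>2 * V (\<phi> t) \<le> (x t)\<^sup>2 * C" by (rule mult_left_mono) simp
    then have "\<gamma>/2 * w t \<le> \<gamma>/2 * ((x t)\<^sup>2 * C / 3)" using \<gamma>_pos by (intro mult_left_mono) (auto simp: w_def)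
    also have "\<dots> = 2 * C / 3 * (x t)\<^sup>2 * (\<gamma>/4)" by simp
    also have "\<dots> \<le> 2 * C / 3 * (x t)\<^sup>2 * ((y t)\<^sup>2 + \<gamma>/2 * (z t)\<^sup>2)"
      using g C(1) by (intro mult_left_mono) auto
    also have "\<dots> = C/3 * (2 * x t * x' t)" by (simp add: x'_def power2_eq_square)
    finally show ?thesis using E'[OF t0] by simp
  qed
  show ?thesis
  proof (cases "\<exists>m. \<forall>t\<le>T. m \<le> E t")
    case True
    then obtain m where m: "\<And>t. t \<le> T \<Longrightarrow> m \<le> E t" by blast
    obtain M where M: "M \<ge> 0" "\<And>t. t \<le> 0 \<Longrightarrow> \<bar>y' t\<bar> \<le> M"
      by (rule derivs_bounded) blast
    have "((\<lambda>t. b * (y t)\<^sup>2) \<longlongrightarrow> 0) at_bot"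
    proof (rule barbalat)
      fix t assume t: "t \<le> T"
      show "(E has_real_derivative E' t) (at t)" using Ed T(1) t by blast
      show "b * (y t)\<^sup>2 \<le> E' t" by (rule El[OF t])
      show "((\<lambda>t. b * (y t)\<^sup>2) has_real_derivative b * (2 * y t * y' t)) (at t)"
        using DERIV_cmult[OF DERIV_power[OF derivs_at(2)[OF T(1)[OF t]], of 2], of b] by (simp add: mult_ac)
      have "\<bar>y t * y' t\<bar> \<le> 1 * M"
        unfolding abs_mult using yz_bounded[of t] M(2)[of t] T(1)[OF t] by (intro mult_mono) auto
      then have "b * (2 * \<bar>y t * y' t\<bar>) \<le> 1 * (2 * M)"
        using b by (intro mult_mono) auto
      then show "\<bar>b * (2 * y t * y' t)\<bar> \<le> 2 * M" using b by (simp add: abs_mult mult.assoc)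
    qed (use m b in auto)
    then have "((\<lambda>t. 1 / b * (b * (y t)\<^sup>2)) \<longlongrightarrow> 0) at_bot" by (rule tendsto_mult_right_zero)
    then have "((\<lambda>t. (y t)\<^sup>2) \<longlongrightarrow> 0) at_bot" using b by simp
    then show ?thesis by (rule sq_null)
  next
    case False
    \<comment> \<open>E t < m forces z t < 1/2; together with w t < 1/4 the constraint leaves y^2
      \<ge> 1/4.\<close>
    define m where "m = - ln 2 - \<bar>a\<bar> * D"
    obtain t0 where t0: "t0 \<le> T" "E t0 < m" using False by (auto simp: not_le)
    have y: "\<bar>y t\<bar> \<ge> 1/2" if t: "t \<le> t0" for t
    proof -
      have tT: "t \<le> T" using t t0 by simp
      note tn = T(1)[OF tT]
      have "E t \<le> E t0"
      proof (rule DERIV_nonneg_imp_nondecreasing[OF t])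
        fix r assume r: "t \<le> r" "r \<le> t0"
        then have rT: "r \<le> T" using t0 by simp
        have "0 \<le> b * (y r)\<^sup>2" using b by simp
        then show "\<exists>d. (E has_real_derivative d) (at r) \<and> 0 \<le> d"
          using Ed[OF T(1)[OF rT]] El[OF rT] by (intro exI[of _ "E' r"]) auto
      qed
      then have "E t < m" using t0 by simp
      moreover have "\<bar>a * ln (\<kappa> (\<phi> t))\<bar> \<le> \<bar>a\<bar> * D"
        unfolding abs_mult using D(2)[of "\<phi> t"] components(4)[of t] tn by (intro mult_left_mono) auto
      moreover have "C/3 * (x t)\<^sup>2 \<ge> 0" using C by simp
      ultimately have "ln (z t) < - ln 2" unfolding E_def m_def by linarith
      then have "ln (z t) < ln (1/2)" by (simp add: ln_div)
      then have "z t < 1/2" using zp[OF tn] by simp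
      then have "(z t)\<^sup>2 < (1/2)\<^sup>2" using zp[OF tn] by (intro power_strict_mono) auto
      then have "(y t)\<^sup>2 \<ge> (1/2)\<^sup>2" using components(3)[of t] T(2)[OF tT] tn by (simp add: power2_eq_square)
      then show ?thesis using abs_le_square_iff[of "1/2" "y t"] by simp
    qed
    \<comment> \<open>At speed at least s/2 during this time, \<phi> would move by 2|B| + 2, more
      than the range [-B, B] allows.\<close>
    define t1 where "t1 = t0 - (4 * \<bar>B\<bar> + 4) / s"
    have t1: "t1 < t0" using s by (simp add: t1_def add_nonneg_pos)
    obtain \<xi> where \<xi>: "t1 < \<xi>" "\<xi> < t0" "\<phi> t0 - \<phi> t1 = (t0 - t1) * (s * y \<xi>)"
      using MVT2[OF t1, of \<phi> "\<lambda>t. s * y t"] derivs_at(4) T(1) t0(1) unfolding s_def by fastforce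
    have "\<bar>\<phi> t0 - \<phi> t1\<bar> = (t0 - t1) * (s * \<bar>y \<xi>\<bar>)" using \<xi> s t1 by (simp add: abs_mult)
    also have "\<dots> \<ge> (t0 - t1) * (s * (1/2))"
      using y[of \<xi>] \<xi> s t1 by (intro mult_left_mono) auto
    also have "(t0 - t1) * (s * (1/2)) = 2 * \<bar>B\<bar> + 2" using s by (simp add: t1_def)
    finally have "2 * \<bar>B\<bar> + 2 \<le> \<bar>\<phi> t0 - \<phi> t1\<bar>" .
    moreover have "\<bar>\<phi> t0\<bar> \<le> B" "\<bar>\<phi> t1\<bar> \<le> B" using components(4) T(1)[OF t0(1)] t1 by auto
    ultimately show ?thesis by linarith
  qed
qed

lemma z_tendsto:
  assumes "z 0 > 0"
  shows "(z \<longlongrightarrow> 1) at_bot"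
proof -
  have "((\<lambda>t. sqrt (1 - (y t)\<^sup>2 - w t)) \<longlongrightarrow> sqrt (1 - 0\<^sup>2 - 0)) at_bot"
    by (intro tendsto_intros y_null w_null assms)
  moreover have "\<forall>\<^sub>F t in at_bot. sqrt (1 - (y t)\<^sup>2 - w t) = z t"
    using eventually_neg
  proof eventually_elim
    case (elim t)
    then have "1 - (y t)\<^sup>2 - w t = (z t)\<^sup>2" "z t \<ge> 0" using components[of t] by auto
    then show ?case by simp
  qed
  ultimately show ?thesis using filterlim_cong[OF refl refl] by force
qed

text \<open>What remains of \<open>y'\<close> after z^2 has been eliminated by the constraint and
  \<open>A \<phi>\<close> and the term linear in y have been split off; every summand is at least
  quadratic in (x, y).\<close>

definition R where "R t = (y t)\<^sup>2 * y t - ((y t)\<^sup>2 + w t) * (\<gamma>/2 * y t + A (\<phi> t))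
   - (x t)\<^sup>2 * (deriv V (\<phi> t) / (3 * sqrt 6))"

lemma y'_eq:
  assumes "t \<le> 0"
  shows "y' t = A (\<phi> t) - (1 - \<gamma>/2) * y t + R t"
proof -
  have z: "(z t)\<^sup>2 = 1 - ((y t)\<^sup>2 + w t)" using components(3)[OF assms] by simp
  show ?thesis unfolding y'_def R_def z
    by (simp add: algebra_simps power2_eq_square power3_eq_cube)
qed

text \<open>As y tends to 0, so does its increment over a unit of time, hence \<open>y'\<close> is
  small at some intermediate time. There \<open>A \<phi>\<close> is small too, since
  \<open>y'\<close> and \<open>A \<phi>\<close> differ by a null function. Within a unit of time
  \<phi> hardly moves, because its velocity is a multiple of y.\<close>

lemma A_phi_null:
  assumes z0: "z 0 > 0"
  shows "((\<lambda>t. A (\<phi> t)) \<longlongrightarrow> 0) at_bot"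
proof -
  define s where "s = sqrt (2/3)"
  have s: "s > 0" "s \<le> 1" by (auto simp: s_def)
  have null: "((\<lambda>t. f t * h (\<phi> t)) \<longlongrightarrow> 0) at_bot" 
    if f: "(f \<longlongrightarrow> 0) at_bot" and h: "continuous_on {-B..B} h" for f h :: "real \<Rightarrow> real"
  proof -
    obtain C where C: "C > 0" "\<And>t. \<bar>t\<bar> \<le> B \<Longrightarrow> \<bar>h t\<bar> \<le> C"
      by (rule bounded_on_compact[OF h]) blast
    have "\<forall>\<^sub>F t in at_bot. norm (f t * h (\<phi> t)) \<le> C * \<bar>f t\<bar>"
      using eventually_neg
    proof eventually_elim
      case (elim t)
      then have "\<bar>h (\<phi> t)\<bar> \<le> C" using C(2) components(4)[of t] by simp
      then show ?case using mult_left_mono[of "\<bar>h (\<phi> t)\<bar>" C "\<bar>f t\<bar>"] by (simp add: abs_mult mult.commute)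
    qed
    moreover have "((\<lambda>t. C * \<bar>f t\<bar>) \<longlongrightarrow> 0) at_bot"
      by (intro tendsto_mult_right_zero tendsto_rabs_zero f)
    ultimately show ?thesis by (rule Lim_null_comparison)
  qed
  have w2: "((\<lambda>t. (y t)\<^sup>2 + w t) \<longlongrightarrow> 0) at_bot"
    using tendsto_add[OF tendsto_power[OF y_null[OF z0], of 2] w_null[OF z0]] by simp
  have cV: "continuous_on {-B..B} (\<lambda>p. deriv V p / (3 * sqrt 6))"
    using continuous_on_subset[OF continuous_deriv(1)] by (intro continuous_intros) auto
  have x2: "((\<lambda>t. (x t)\<^sup>2) \<longlongrightarrow> 0) at_bot"
    using tendsto_power[OF x_null[OF z0], of 2] by simp
  have "((\<lambda>t. ((y t)\<^sup>2 * y t - (((y t)\<^sup>2 + w t) * (\<gamma>/2 * y t) + ((y t)\<^sup>2 + w t) * A (\<phi> t))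
     - (x t)\<^sup>2 * (deriv V (\<phi> t) / (3 * sqrt 6))) - (1 - \<gamma>/2) * y t) \<longlongrightarrow> (0\<^sup>2 * 0 - (0 * (\<gamma>/2 * 0) + 0) - 0) - (1 - \<gamma>/2) * 0) at_bot"
    by (intro tendsto_intros y_null[OF z0] w2 null[OF w2] null[OF x2 cV] continuous_A)
  then have Rn: "((\<lambda>t. R t - (1 - \<gamma>/2) * y t) \<longlongrightarrow> 0) at_bot"
    unfolding R_def by (simp add: distrib_left)
  obtain L where L: "L \<ge> 0" "\<And>p. p \<in> {-B..B} \<Longrightarrow> \<bar>A p\<bar> \<le> L"
     "\<And>p q. p \<in> {-B..B} \<Longrightarrow> q \<in> {-B..B} \<Longrightarrow> \<bar>A p - A q\<bar> \<le> L * dist p q"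
    by (rule bounded_lipschitz_onE[OF bounded_lipschitz_A]) blast
  show ?thesis
  proof (rule tendstoI)
    fix e0 :: real assume "e0 > 0"
    \<comment> \<open>The increment of y costs 2 e, the difference between \<open>y'\<close> and
      \<open>A \<phi>\<close> costs e, and the drift of \<phi> up to t costs L e.\<close>
    define e where "e = e0 / (4 + L)"
    have e: "e > 0" "(4 + L) * e = e0" using \<open>e0 > 0\<close> L by (auto simp: e_def)
    have "\<forall>\<^sub>F t in at_bot. t < 0 \<and> \<bar>R t - (1 - \<gamma>/2) * y t\<bar> < e \<and> \<bar>y t\<bar> < e"
      using eventually_neg tendstoD[OF Rn e(1)] tendstoD[OF y_null[OF z0] e(1)]
      by eventually_elim (simp add: dist_real_def)
    then obtain T where T: "\<And>t. t \<le> T \<Longrightarrow> t < 0" "\<And>t. t \<le> T \<Longrightarrow> \<bar>R t - (1 - \<gamma>/2) * y t\<bar> < e"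
      "\<And>t. t \<le> T \<Longrightarrow> \<bar>y t\<bar> < e"
      unfolding eventually_at_bot_linorder by blast
    have "dist (A (\<phi> t)) 0 < e0" if t: "t \<le> T" for t
    proof -
      have "\<exists>\<xi>. t - 1 < \<xi> \<and> \<xi> < t \<and> y t - y (t - 1) = (t - (t - 1)) * y' \<xi>"
        using T(1) t by (intro MVT2) (auto intro!: derivs_at)
      then obtain \<xi> where \<xi>: "t - 1 < \<xi>" "\<xi> < t" "y t - y (t - 1) = y' \<xi>" by auto
      have "\<exists>\<zeta>. \<xi> < \<zeta> \<and> \<zeta> < t \<and> \<phi> t - \<phi> \<xi> = (t - \<xi>) * (s * y \<zeta>)"
        unfolding s_def using T(1) t \<xi> by (intro MVT2) (auto intro!: derivs_at)
      then obtain \<zeta> where \<zeta>: "\<xi> < \<zeta>" "\<zeta> < t" "\<phi> t - \<phi> \<xi> = (t - \<xi>) * (s * y \<zeta>)" by auto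
      have y\<zeta>: "\<bar>y \<zeta>\<bar> < e" using T(3)[of \<zeta>] \<zeta> t by simp
      have "\<bar>\<phi> t - \<phi> \<xi>\<bar> = (t - \<xi>) * (s * \<bar>y \<zeta>\<bar>)" using \<xi> \<zeta> s by (simp add: abs_mult)
      also have "\<dots> \<le> 1 * (1 * e)"
        using \<xi> s y\<zeta> by (intro mult_mono) auto
      finally have "\<bar>\<phi> t - \<phi> \<xi>\<bar> \<le> e" by simp
      then have "L * \<bar>\<phi> t - \<phi> \<xi>\<bar> \<le> L * e" using L(1) by (rule mult_left_mono)
      moreover have "\<bar>A (\<phi> t) - A (\<phi> \<xi>)\<bar> \<le> L * \<bar>\<phi> t - \<phi> \<xi>\<bar>"
        using L(3)[of "\<phi> t" "\<phi> \<xi>"] components(4)[of t] components(4)[of \<xi>] T(1)[OF t] \<xi> by (auto simp: dist_real_def abs_le_iff)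
      ultimately have 1: "\<bar>A (\<phi> t) - A (\<phi> \<xi>)\<bar> \<le> L * e" by linarith
      have "\<bar>y' \<xi>\<bar> < 2 * e" using T(3)[of t] T(3)[of "t - 1"] t unfolding \<xi>(3)[symmetric] by simp
      moreover have "y' \<xi> = A (\<phi> \<xi>) + (R \<xi> - (1 - \<gamma>/2) * y \<xi>)"
        using y'_eq[of \<xi>] T(1)[of \<xi>] \<xi> t by simp
      moreover have "\<bar>R \<xi> - (1 - \<gamma>/2) * y \<xi>\<bar> < e" using T(2)[of \<xi>] \<xi> t by simp
      ultimately have "\<bar>A (\<phi> \<xi>)\<bar> < 3 * e" by linarith
      then have "\<bar>A (\<phi> t)\<bar> < (4 + L) * e" using 1 e(1) by (simp add: distrib_right)
      then show ?thesis using e(2) by simp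
    qed
    then show "\<forall>\<^sub>F t in at_bot. dist (A (\<phi> t)) 0 < e0"
      unfolding eventually_at_bot_linorder by blast
  qed
qed

end

subsection \<open>Existence of bounded past orbits\<close>

context scalar_field begin

text \<open>Each of x, z and the defect \<open>S\<close> of the constraint solves a scalar linear
  equation with continuous coefficient, so its sign or its vanishing at 0 passes to the earlier
  time.\<close>

lemma Sigma_invariant:
  assumes t: "t \<le> 0"
    and d: "\<And>s. t \<le> s \<Longrightarrow> s \<le> 0 \<Longrightarrow> (u has_vector_derivative ode_field \<gamma> V \<kappa> (u s)) (at s within {t..0})"
    and u0: "u 0 \<in> Sigma_state V"
  shows "u t \<in> Sigma_state V"
proof -
  define x y z \<phi> where "x s = fst (u s)" and "y s = fst (snd (u s))" and "z s = fst (snd (snd (u s)))"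
    and "\<phi> s = snd (snd (snd (u s)))" for s
  have u: "u s = (x s, y s, z s, \<phi> s)" for s by (simp add: x_def y_def z_def \<phi>_def)
  \<comment> \<open>Expressing sqrt 6 through k as well makes the identity for the derivative of
    \<open>S\<close> a polynomial one, with no relation between two roots.\<close>
  define k where "k = sqrt (2/3)"
  have k: "sqrt 6 = 2 / k"
    unfolding k_def by (simp add: real_sqrt_divide real_sqrt_mult[of 2 3, simplified] field_simps)
  have "k > 0" by (simp add: k_def)
  define gx gz where "gx s = (y s)\<^sup>2 + \<gamma>/2 * (z s)\<^sup>2"
    and "gz s = (y s)\<^sup>2 + ((z s)\<^sup>2 - 1) * (\<gamma>/2) - A (\<phi> s) * y s" for s
  define y' where "y' s = y s ^ 3 + 1/2 * (\<gamma> * (z s)\<^sup>2 - 2) * y s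
     - (x s)\<^sup>2 * deriv V (\<phi> s) * k / 6 + A (\<phi> s) * (z s)\<^sup>2" for s
  have F: "ode_field \<gamma> V \<kappa> (u s) = (x s * gx s, y' s, z s * gz s, k * y s)" for s
    unfolding u[of s] ode_field_eq gx_def gz_def y'_def k using \<open>k > 0\<close> by (simp add: k_def)
  have ds: "(x has_real_derivative x s * gx s) (at s within {t..0})"
    "(y has_real_derivative y' s) (at s within {t..0})"
    "(z has_real_derivative z s * gz s) (at s within {t..0})"
    "(\<phi> has_real_derivative k * y s) (at s within {t..0})" if "t \<le> s" "s \<le> 0" for s
    using has_derivative_components[OF d[OF that, unfolded F]]
    unfolding x_def[abs_def] y_def[abs_def] z_def[abs_def] \<phi>_def[abs_def] by auto
  have c: "continuous_on {t..0} x" "continuous_on {t..0} y" "continuous_on {t..0} z" "continuous_on {t..0} \<phi>"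
    by (rule DERIV_continuous_on, rule ds, simp, simp)+
  have cgx: "continuous_on {t..0} gx" unfolding gx_def by (intro continuous_intros c)
  have cgz: "continuous_on {t..0} gz" unfolding gz_def 
    by (intro continuous_intros c continuous_on_compose2[OF continuous_A[of UNIV] c(4)]) auto
  obtain e1 where e1: "e1 > 0" "x t = x 0 * e1"
    by (rule linear_ode_factor[OF t ds(1) cgx])
  obtain e2 where e2: "e2 > 0" "z t = z 0 * e2"
    by (rule linear_ode_factor[OF t ds(3) cgz])
  define S where "S s = (y s)\<^sup>2 + (z s)\<^sup>2 + 1/3 * (x s)\<^sup>2 * V (\<phi> s) - 1" for s
  have dS: "(S has_real_derivative S s * (2 * gx s)) (at s within {t..0})" if s: "t \<le> s" "s \<le> 0" for s
  proof -
    have "((\<lambda>s. V (\<phi> s)) has_real_derivative deriv V (\<phi> s) * (k * y s)) (at s within {t..0})"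
      by (rule DERIV_chain2[OF V_deriv ds(4)[OF s]])
    then have "(S has_real_derivative 2 * y s * y' s + 2 * z s * (z s * gz s)
        + 1/3 * (2 * x s * (x s * gx s) * V (\<phi> s) + (x s)\<^sup>2 * (deriv V (\<phi> s) * (k * y s)))) (at s within {t..0})"
      unfolding S_def using ds[OF s] by (auto intro!: derivative_eq_intros simp: algebra_simps)
    moreover have "2 * y s * y' s + 2 * z s * (z s * gz s)
        + 1/3 * (2 * x s * (x s * gx s) * V (\<phi> s) + (x s)\<^sup>2 * (deriv V (\<phi> s) * (k * y s))) = S s * (2 * gx s)"
      unfolding S_def y'_def gz_def gx_def
      by (simp add: field_simps power2_eq_square power3_eq_cube)
    ultimately show ?thesis by simp
  qed
  have c2: "continuous_on {t..0} (\<lambda>s. 2 * gx s)" by (intro continuous_intros cgx)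
  obtain e where "S t = S 0 * e" by (rule linear_ode_factor[OF t dS c2])
  moreover have "x 0 \<ge> 0 \<and> z 0 \<ge> 0 \<and> (y 0)\<^sup>2 + (z 0)\<^sup>2 + 1/3 * (x 0)\<^sup>2 * V (\<phi> 0) = 1"
    using u0 unfolding u[of 0] Sigma_state_def mem_Collect_eq prod.case .
  ultimately have "x t \<ge> 0 \<and> z t \<ge> 0 \<and> (y t)\<^sup>2 + (z t)\<^sup>2 + 1/3 * (x t)\<^sup>2 * V (\<phi> t) = 1"
    using e1 e2 by (simp add: S_def)
  then show ?thesis unfolding u[of t] Sigma_state_def mem_Collect_eq prod.case .
qed

lemma convex_state_box: "convex (state_box X B)" and closed_state_box: "closed (state_box X B)"
  unfolding state_box_def by (intro convex_Times closed_Times; simp)+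

text \<open>Composing the field with the projection to a convex compact box makes it bounded and
  globally Lipschitz, so a solution on the whole past exists. While it stays in the box it is an
  orbit of the original system, hence lies on \<Sigma> with |\<phi>| \<le> B, which is strictly
  inside the box. It can therefore never leave.\<close>

lemma global_past_orbit:
  assumes p: "p \<in> Sigma_state V"
    and bdd: "bdd_above ((\<lambda>q. \<bar>phi_of q\<bar>) ` past_orbit \<gamma> V \<kappa> p)"
  obtains B u where "bounded_past_orbit \<gamma> V \<kappa> B u" "u 0 = p"
proof -
  let ?F = "ode_field \<gamma> V \<kappa>"
  obtain B0 where B0: "\<And>q. q \<in> past_orbit \<gamma> V \<kappa> p \<Longrightarrow> \<bar>phi_of q\<bar> \<le> B0"
    using bdd unfolding bdd_above_def by blast
  define B where "B = max B0 \<bar>phi_of p\<bar>"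
  have Bp: "\<bar>phi_of p\<bar> \<le> B" "B \<ge> 0" by (auto simp: B_def)
  have Bo: "\<bar>phi_of q\<bar> \<le> B" if "q \<in> past_orbit \<gamma> V \<kappa> p" for q
    using B0[OF that] by (simp add: B_def)
  obtain X where X: "\<And>p. p \<in> Sigma_state V \<Longrightarrow> \<bar>phi_of p\<bar> \<le> B \<Longrightarrow> fst p \<le> X"
    using Sigma_x_bounded by blast
  define K where "K = state_box (\<bar>X\<bar> + 1) (B + 1)"
  define Om :: "state set" where "Om = {-(\<bar>X\<bar>+1)<..<\<bar>X\<bar>+1} \<times> {-2<..<2} \<times> {-2<..<2} \<times> {-(B+1)<..<B+1}"
  have oOm: "open Om" unfolding Om_def by (intro open_Times open_greaterThanLessThan)
  have OmK: "Om \<subseteq> K" by (auto simp: Om_def K_def state_box_def)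
  have SOm: "q \<in> Om" if q: "q \<in> Sigma_state V" and "\<bar>phi_of q\<bar> \<le> B" for q
  proof -
    obtain x y z \<phi> where e: "q = (x, y, z, \<phi>)" by (cases q) auto
    have s: "x \<ge> 0 \<and> z \<ge> 0 \<and> y\<^sup>2 + z\<^sup>2 + 1/3 * x\<^sup>2 * V \<phi> = 1"
      using q unfolding e Sigma_state_def mem_Collect_eq prod.case .
    have "1/3 * x\<^sup>2 * V \<phi> \<ge> 0" using V_pos[of \<phi>] by simp
    then have "y\<^sup>2 \<le> 1" "z\<^sup>2 \<le> 1" using s zero_le_power2[of y] zero_le_power2[of z] by linarith+
    then have "\<bar>y\<bar> \<le> 1" "\<bar>z\<bar> \<le> 1" by (simp_all add: abs_square_le_1)
    then show ?thesis using X[OF that] that(2) s by (auto simp: e Om_def phi_of_def)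
  qed
  have cK: "closed K" and vK: "convex K" unfolding K_def by (rule closed_state_box convex_state_box)+
  have pK: "p \<in> K" using SOm[OF p Bp(1)] OmK by blast
  obtain L where L: "L \<ge> 0" "\<And>p. p \<in> K \<Longrightarrow> norm (?F p) \<le> L"
    "\<And>p q. p \<in> K \<Longrightarrow> q \<in> K \<Longrightarrow> norm (?F p - ?F q) \<le> L * norm (p - q)"
    unfolding K_def by (rule ode_field_lipschitz[of "\<bar>X\<bar> + 1" "B + 1"]) blast
  define G where "G q = ?F (closest_point K q)" for q
  have cpK: "closest_point K q \<in> K" for q by (rule closest_point_in_set[OF cK]) (use pK in blast)
  have GL: "norm (G a - G b) \<le> L * norm (a - b)" for a b
  proof -
    have "norm (G a - G b) \<le> L * norm (closest_point K a - closest_point K b)"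
      unfolding G_def by (rule L(3)[OF cpK cpK])
    also have "\<dots> \<le> L * norm (a - b)"
      using closest_point_lipschitz[OF vK cK, of a b] pK L(1) by (intro mult_left_mono) (auto simp: dist_norm)
    finally show ?thesis .
  qed
  have GB: "norm (G a) \<le> L" for a unfolding G_def by (rule L(2)[OF cpK])
  obtain u where u: "u 0 = p" "\<And>t. t \<le> 0 \<Longrightarrow> (u has_vector_derivative G (u t)) (at t within {..0})"
    using global_past_solution[of G, OF GL GB] by blast
  have small: "u t \<in> Sigma_state V \<and> \<bar>phi_of (u t)\<bar> \<le> B" if t: "t \<le> 0" and K: "\<And>s. t \<le> s \<Longrightarrow> s \<le> 0 \<Longrightarrow> u s \<in> K" for t
  proof -
    have d: "(u has_vector_derivative ?F (u s)) (at s within {t..0})" if s: "t \<le> s" "s \<le> 0" for s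
    proof -
      have "G (u s) = ?F (u s)" unfolding G_def by (simp add: closest_point_self K[OF s])
      then show ?thesis using has_vector_derivative_within_subset[OF u(2)[OF s(2)], of "{t..0}"] by auto
    qed
    have "u t \<in> past_orbit \<gamma> V \<kappa> p" unfolding past_orbit_def mem_Collect_eq
      by (intro exI[of _ t] exI[of _ u] conjI t u(1) refl ballI d) auto
    then show ?thesis using Bo Sigma_invariant[OF t d] p u(1) by simp
  qed
  have uc: "\<exists>\<delta>>0. \<forall>s\<le>0. \<bar>s - c\<bar> < \<delta> \<longrightarrow> u s \<in> O'" if "c \<le> 0" "open O'" "u c \<in> O'" for c O'
  proof -
    have "continuous (at c within {..0}) u" using u(2)[OF that(1)] by (rule has_vector_derivative_continuous)
    then have "\<forall>\<^sub>F s in at c within {..0}. u s \<in> O'"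
      using that(2,3) unfolding continuous_within by (rule topological_tendstoD)
    then obtain \<delta> where "\<delta> > 0" "\<And>s. s \<le> 0 \<Longrightarrow> s \<noteq> c \<Longrightarrow> dist s c < \<delta> \<Longrightarrow> u s \<in> O'"
      unfolding eventually_at by auto
    then show ?thesis using that(3) unfolding dist_real_def by blast
  qed
  have all: "u t \<in> K" if "t \<le> 0" for t
  proof (rule ccontr)
    assume nt: "u t \<notin> K"
    define W where "W = {s. s \<le> 0 \<and> u s \<notin> K}"
    \<comment> \<open>The moment at which the solution, followed from 0 into the past, would first
      leave the box.\<close>
    define c where "c = Sup W"
    have W: "W \<noteq> {}" "bdd_above W" using that nt unfolding W_def bdd_above_def by blast+
    have c0: "c \<le> 0" unfolding c_def by (rule cSup_least[OF W(1)]) (simp add: W_def)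
    have cu: "s \<le> c" if "s \<in> W" for s unfolding c_def by (rule cSup_upper[OF that W(2)])
    \<comment> \<open>The complement of the box is open: if u c lay in it, so would u at slightly
      later times, against the choice of c.\<close>
    have cK': "u c \<in> K"
    proof (rule ccontr)
      assume nc: "u c \<notin> K"
      then have "c \<noteq> 0" using pK u(1) by auto
      then have "c < 0" using c0 by simp
      obtain \<delta> where \<delta>: "\<delta> > 0" "\<And>s. s \<le> 0 \<Longrightarrow> \<bar>s - c\<bar> < \<delta> \<Longrightarrow> u s \<in> - K"
        using uc[OF c0, of "- K"] cK nc by auto
      define s where "s = min 0 (c + \<delta>/2)"
      have "s \<le> 0" "\<bar>s - c\<bar> < \<delta>" "s > c" using \<open>c < 0\<close> \<delta>(1) by (auto simp: s_def min_def)
      then have "s \<in> W" using \<delta>(2)[of s] by (simp add: W_def)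
      then show False using cu[of s] \<open>s > c\<close> by simp
    qed
    have "u s \<in> K" if "c \<le> s" "s \<le> 0" for s
      using cu[of s] cK' that unfolding W_def by (cases "s = c") auto
    \<comment> \<open>The solution is strictly inside at time c and so also slightly earlier,
      although c is the supremum of the times spent outside.\<close>
    then have "u c \<in> Om" using small[OF c0] SOm by blast
    then obtain \<delta> where \<delta>: "\<delta> > 0" "\<And>s. s \<le> 0 \<Longrightarrow> \<bar>s - c\<bar> < \<delta> \<Longrightarrow> u s \<in> Om"
      using uc[OF c0 oOm] by blast
    obtain s where s: "s \<in> W" "c - \<delta> < s"
      using less_cSup_iff[OF W, of "c - \<delta>"] \<delta>(1) unfolding c_def by auto
    then have "u s \<in> Om" using \<delta>(2)[of s] cu[of s] by (auto simp: W_def)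
    then show False using s(1) OmK by (auto simp: W_def)
  qed
  show thesis
  proof (rule that)
    show "bounded_past_orbit \<gamma> V \<kappa> B u"
    proof
      fix t :: real assume t: "t \<le> 0"
      have "G (u t) = ?F (u t)" unfolding G_def by (simp add: closest_point_self all[OF t])
      then show "(u has_vector_derivative ?F (u t)) (at t within {..0})" using u(2)[OF t] by simp
      show "u t \<in> Sigma_state V" "\<bar>phi_of (u t)\<bar> \<le> B" using small[OF t] all by auto
    qed
  qed (rule u(1))
qed

end

subsection \<open>Limit points and the cone condition\<close>

lemma field_zero_deriv_on_interval:
  fixes f :: "real \<Rightarrow> real"
  assumes "\<And>v. l < v \<Longrightarrow> v < h \<Longrightarrow> f v = 0" "\<And>v. (f has_real_derivative f' v) (at v)"
    and c: "continuous_on UNIV f'" and "l < h" "l \<le> v" "v \<le> h"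
  shows "f' v = 0"
proof -
  have z: "f' v = 0" if v: "l < v" "v < h" for v
  proof -
    have "((\<lambda>_. 0) has_real_derivative 0) (at v)" by simp
    then have "(f has_real_derivative 0) (at v)"
      by (rule has_field_derivative_transform_within_open[where S = "{l<..<h}"]) (use v assms(1) in auto)
    then show ?thesis using DERIV_unique assms(2) by blast
  qed
  have "closure {l<..<h} = {l..h}" using \<open>l < h\<close> by simp
  then have "v \<in> closure {l<..<h}" using assms by simp
  then show ?thesis
    using continuous_constant_on_closure[of "{l<..<h}" f' 0 v] z continuous_on_subset[OF c] by auto
qed

context bounded_past_orbit begin

text \<open>The limit points of \<open>\<phi>\<close> form an interval on which \<open>A\<close> vanishes. Hence \<open>A'\<close> is constant there,
  even when \<open>\<phi>\<close> does not converge.\<close>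
lemma limit_interval:
  assumes z0: "z 0 > 0" 
  obtains \<alpha> where "\<And>e. e > 0 \<Longrightarrow> \<exists>c\<in>\<rat>. \<exists>d\<in>\<rat>. (\<forall>v\<in>{c..d}. \<bar>A' v - \<alpha>\<bar> \<le> e) \<and> (\<forall>\<^sub>F t in at_bot. \<phi> t \<in> {c..d})"
proof -
  \<comment> \<open>\<open>l\<close> and \<open>h\<close> below are the lower and the upper limit of
    \<phi> as t tends to minus infinity.\<close>
  define lo hi where "lo T = Inf (\<phi> ` {..T})" and "hi T = Sup (\<phi> ` {..T})" for T
  define l h where "l = Sup (lo ` {..0})" and "h = Inf (hi ` {..0})"
  have ph: "-B \<le> \<phi> t" "\<phi> t \<le> B" if "t \<le> 0" for t using components(4)[OF that] by auto
  have bb: "bdd_below (\<phi> ` {..T})" and ba: "bdd_above (\<phi> ` {..T})" if "T \<le> 0" for T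
    unfolding bdd_below_def bdd_above_def using ph that by (force intro: exI[of _ "-B"] exI[of _ B])+
  have lot: "lo T \<le> \<phi> t" and hit: "\<phi> t \<le> hi T" if "t \<le> T" "T \<le> 0" for t T
    unfolding lo_def hi_def using that by (auto intro!: cInf_lower cSup_upper bb ba)
  have lohi: "lo T \<le> hi T'" if "T \<le> 0" "T' \<le> 0" for T T'
    by (rule order_trans[OF lot[of "min T T'"] hit]) (use that in auto)
  have loh: "lo T \<le> h" if "T \<le> 0" for T
    unfolding h_def using lohi[OF that] by (intro cInf_greatest) auto
  have blo: "bdd_above (lo ` {..0})" unfolding bdd_above_def using loh by blast
  have bhi: "bdd_below (hi ` {..0})" unfolding bdd_below_def using lohi[of 0] by force
  have lh: "l \<le> h" unfolding l_def using loh by (intro cSup_least) auto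
  have lol: "lo T \<le> l" if "T \<le> 0" for T unfolding l_def using that blo by (intro cSup_upper) auto
  have hhi: "h \<le> hi T" if "T \<le> 0" for T unfolding h_def using that bhi by (intro cInf_lower) auto
  \<comment> \<open>By connectedness \<phi> takes the value v arbitrarily far in the past, where
    \<open>A \<phi>\<close> is arbitrarily small.\<close>
  have Az: "A v = 0" if v: "l < v" "v < h" for v
  proof (rule ccontr)
    assume "A v \<noteq> 0"
    then have "\<forall>\<^sub>F t in at_bot. dist (A (\<phi> t)) 0 < \<bar>A v\<bar>"
      by (intro tendstoD[OF A_phi_null[OF z0]]) simp
    then have "\<forall>\<^sub>F t in at_bot. t < 0 \<and> \<bar>A (\<phi> t)\<bar> < \<bar>A v\<bar>" using eventually_neg by eventually_elim simp
    then obtain T where T: "\<And>t. t \<le> T \<Longrightarrow> t < 0" "\<And>t. t \<le> T \<Longrightarrow> \<bar>A (\<phi> t)\<bar> < \<bar>A v\<bar>"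
      unfolding eventually_at_bot_linorder by blast
    have T0: "T \<le> 0" using T(1)[of T] by simp
    have "lo T < v" "v < hi T" using lol[OF T0] hhi[OF T0] v by auto
    then obtain t1 t2 where t: "t1 \<le> T" "\<phi> t1 < v" "t2 \<le> T" "v < \<phi> t2"
      unfolding lo_def hi_def using cInf_lessD[of "\<phi> ` {..T}" v] less_cSupD[of "\<phi> ` {..T}" v] by auto
    have "connected (\<phi> ` {..T})"
      by (intro connected_continuous_image continuous_components) (use T0 in auto)
    then have "v \<in> \<phi> ` {..T}"
      using connectedD_interval[of "\<phi> ` {..T}" "\<phi> t1" "\<phi> t2" v] t by auto
    then show False using T(2) by force
  qed
  have A'c: "A' v = A' l" if v: "l \<le> v" "v \<le> h" for v
  proof (cases "l = h")
    case False
    then have "A' r = 0" if "l \<le> r" "r \<le> h" for r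
      using field_zero_deriv_on_interval[of l h A A' r] Az A_deriv continuous_deriv(4) lh that by auto
    then show ?thesis using v lh by simp
  qed (use v in auto)
  show thesis
  proof (rule that)
    fix e :: real assume e: "e > 0"
    have co: "\<exists>\<delta>>0. \<forall>v. \<bar>v - r\<bar> < \<delta> \<longrightarrow> \<bar>A' v - A' r\<bar> < e" for r
      using continuous_deriv(4) e unfolding continuous_on_iff dist_real_def by (meson UNIV_I)
    obtain \<delta>1 where \<delta>1: "\<delta>1 > 0" "\<And>v. \<bar>v - l\<bar> < \<delta>1 \<Longrightarrow> \<bar>A' v - A' l\<bar> < e" using co by blast
    obtain \<delta>2 where \<delta>2: "\<delta>2 > 0" "\<And>v. \<bar>v - h\<bar> < \<delta>2 \<Longrightarrow> \<bar>A' v - A' h\<bar> < e" using co by blast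
    \<comment> \<open>c < l and h < d are strict so that \<phi> is eventually between c and d;
      rational endpoints keep the final cover countable.\<close>
    obtain c where c: "c \<in> \<rat>" "l - \<delta>1 < c" "c < l" using Rats_dense_in_real[of "l - \<delta>1" l] \<delta>1 by auto
    obtain d where d: "d \<in> \<rat>" "h < d" "d < h + \<delta>2" using Rats_dense_in_real[of h "h + \<delta>2"] \<delta>2 by auto
    have "\<bar>A' v - A' l\<bar> \<le> e" if v: "v \<in> {c..d}" for v
    proof -
      consider "v < l" | "l \<le> v \<and> v \<le> h" | "h < v" by linarith
      then show ?thesis
      proof cases
        case 1 then show ?thesis using \<delta>1(2)[of v] v c by auto
      next
        case 2 then show ?thesis using A'c[of v] e by simp
      next
        case 3 then show ?thesis using \<delta>2(2)[of v] v d A'c[of h] lh by auto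
      qed
    qed
    moreover have "\<forall>\<^sub>F t in at_bot. \<phi> t \<in> {c..d}"
    proof -
      obtain T1 where T1: "T1 \<le> 0" "c < lo T1"
        using less_cSupD[of "lo ` {..0}" c] c unfolding l_def by auto
      obtain T2 where T2: "T2 \<le> 0" "hi T2 < d"
        using cInf_lessD[of "hi ` {..0}" d] d unfolding h_def by auto
      have "\<phi> t \<in> {c..d}" if "t \<le> min T1 T2" for t
        using lot[of t T1] hit[of t T2] T1 T2 that by auto
      then show ?thesis unfolding eventually_at_bot_linorder by blast
    qed
    ultimately show "\<exists>c\<in>\<rat>. \<exists>d\<in>\<rat>. (\<forall>v\<in>{c..d}. \<bar>A' v - A' l\<bar> \<le> e) \<and> (\<forall>\<^sub>F t in at_bot. \<phi> t \<in> {c..d})"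
      using c(1) d(1) by blast
  qed
qed

end

section \<open>The reduced system in the coordinates (x, y, \<phi>)\<close>

definition slab :: "real \<Rightarrow> real \<Rightarrow> (real \<times> real \<times> real) set" where
  "slab B \<eta> = {-\<eta>..\<eta>} \<times> {-\<eta>..\<eta>} \<times> {-B..B}"

context scalar_field begin

text \<open>On \<open>\<Sigma>\<close> the variable \<open>z\<close> is eliminated by \<open>z\<^sup>2 = 1 - W3 (x, y, \<phi>)\<close>.\<close>
definition W3 :: "real \<times> real \<times> real \<Rightarrow> real" where
  "W3 p = fst (snd p) * fst (snd p) + fst p * fst p * (V (snd (snd p)) / 3)"

text \<open>\<open>Rx\<close> and \<open>Ry\<close> are the parts of x' and y' that vanish to second
  order at x = y = 0. Squares are spelt as products to match the closure rules for small
  functions.\<close>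

definition Rx :: "real \<times> real \<times> real \<Rightarrow> real" where
  "Rx p = fst (snd p) * fst (snd p) * fst p - W3 p * (\<gamma>/2 * fst p)"

definition Ry :: "real \<times> real \<times> real \<Rightarrow> real" where
  "Ry p = fst (snd p) * fst (snd p) * fst (snd p) - W3 p * (\<gamma>/2 * fst (snd p) + A (snd (snd p)))
    - fst p * fst p * (deriv V (snd (snd p)) / (3 * sqrt 6))"

lemma dist_coordinates3:
  fixes p q :: "real \<times> real \<times> real"
  shows "\<bar>fst p - fst q\<bar> \<le> dist p q" "\<bar>fst (snd p) - fst (snd q)\<bar> \<le> dist p q"
    "\<bar>snd (snd p) - snd (snd q)\<bar> \<le> dist p q"
  unfolding dist_real_def[symmetric] by (meson dist_fst_le dist_snd_le order_trans)+

text \<open>On \<open>slab B \<eta>\<close> both x and y have size at most \<eta>, so x^2 and y^2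
  are small. Every other term is one of these, or W3, times a bounded Lipschitz factor.\<close>

lemma small_Rx_Ry: "small_lipschitz (slab B) W3" "small_lipschitz (slab B) Rx" "small_lipschitz (slab B) Ry"
proof -
  let ?U = "\<Union>\<eta>\<in>{0<..1}. slab B \<eta>"
  have U: "?U \<subseteq> {-1..1} \<times> {-1..1} \<times> {-B..B}" by (force simp: slab_def)
  have U1: "\<bar>fst p\<bar> \<le> 1" "\<bar>fst (snd p)\<bar> \<le> 1" if "p \<in> ?U" for p
    using subsetD[OF U that] by auto
  have bx: "bounded_lipschitz_on ?U fst"
    by (rule bounded_lipschitz_onI[of _ _ 1 1], rule U1, assumption, simp only: mult_1, rule dist_coordinates3)
  have "bounded_lipschitz_on ?U (\<lambda>p. fst (snd p))"
    by (rule bounded_lipschitz_onI[of _ _ 1 1], rule U1, assumption, simp only: mult_1, rule dist_coordinates3)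
  moreover have bh: "bounded_lipschitz_on ?U (\<lambda>p. h (snd (snd p)))" if "bounded_lipschitz_on {-B..B} h" for h
    by (rule bounded_lipschitz_on_compose[OF that]) (use U in \<open>auto simp: dist_coordinates3 dist_real_def\<close>)
  note b = bx calculation bh bounded_lipschitz_on_const bounded_lipschitz_on_add bounded_lipschitz_on_mult
    bounded_lipschitz_on_divide_const bounded_lipschitz_V bounded_lipschitz_V' bounded_lipschitz_A
    bounded_lipschitz_on_uminus
  have xx: "small_lipschitz (slab B) (\<lambda>p. fst p * fst p)"
    by (rule small_lipschitz_prod) (auto simp: slab_def dist_coordinates3)
  have yy: "small_lipschitz (slab B) (\<lambda>p. fst (snd p) * fst (snd p))"
    by (rule small_lipschitz_prod) (auto simp: slab_def dist_coordinates3)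
  have W: "small_lipschitz (slab B) (\<lambda>p. W3 p)"
    unfolding W3_def by (intro small_lipschitz_add small_lipschitz_mult[OF xx] yy b)
  then show "small_lipschitz (slab B) W3" by simp
  have "small_lipschitz (slab B) (\<lambda>p. fst (snd p) * fst (snd p) * fst p + W3 p * (- (\<gamma>/2 * fst p)))"
    by (intro small_lipschitz_add small_lipschitz_mult[OF yy] small_lipschitz_mult[OF W] b)
  then show "small_lipschitz (slab B) Rx" unfolding Rx_def[abs_def] mult_minus_right diff_conv_add_uminus .
  have "small_lipschitz (slab B) (\<lambda>p. fst (snd p) * fst (snd p) * fst (snd p) + W3 p * (- (\<gamma>/2 * fst (snd p) + A (snd (snd p))))
    + fst p * fst p * (- (deriv V (snd (snd p)) / (3 * sqrt 6))))"
    by (intro small_lipschitz_add small_lipschitz_mult[OF yy] small_lipschitz_mult[OF W] small_lipschitz_mult[OF xx] b)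
  then show "small_lipschitz (slab B) Ry" unfolding Ry_def[abs_def] mult_minus_right diff_conv_add_uminus .
qed

definition Gx :: "real \<times> real \<times> real \<Rightarrow> real" where
  "Gx p = \<gamma>/2 * fst p + Rx p"

definition Gy :: "real \<times> real \<times> real \<Rightarrow> real" where
  "Gy p = A (snd (snd p)) - (1 - \<gamma>/2) * fst (snd p) + Ry p"

text \<open>Along the difference of two trajectories, \<open>Q' \<le> -2\<nu> Q\<close> for
  \<open>Q = Y\<^sup>2 + 2\<beta> Y P + \<rho> P\<^sup>2 - X\<^sup>2\<close>.\<close>
definition cone_condition :: "real \<Rightarrow> real \<Rightarrow> real \<Rightarrow> real \<Rightarrow> real \<Rightarrow> real \<Rightarrow> real \<Rightarrow> bool" where
  "cone_condition \<beta> \<rho> \<nu> B \<eta> c d \<longleftrightarrow>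
    (\<forall>p\<in>slab B \<eta>. \<forall>q\<in>slab B \<eta>. snd (snd p) \<in> {c..d} \<longrightarrow> snd (snd q) \<in> {c..d} \<longrightarrow>
      (let X = fst p - fst q; Y = fst (snd p) - fst (snd q); P = snd (snd p) - snd (snd q);
           DX = Gx p - Gx q; DY = Gy p - Gy q; DP = sqrt (2/3) * Y in
        2 * Y * DY + 2 * \<beta> * (DY * P + Y * DP) + 2 * \<rho> * P * DP - 2 * X * DX
          \<le> - 2 * \<nu> * (Y\<^sup>2 + 2 * \<beta> * Y * P + \<rho> * P\<^sup>2 - X\<^sup>2)))"

text \<open>The strict negativity for the linear system absorbs two errors: the deviation of
  \<open>A\<close> from slope \<alpha>, controlled by \<epsilon>, and the remainders, controlled by
  \<eta>. The form and \<epsilon> depend on \<alpha> alone, whereas \<eta> comes after B because the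
  Lipschitz constants of the remainders depend on B.\<close>

lemma cone_condition_exists:
  obtains \<beta> \<rho> \<nu> \<epsilon> where "\<nu> > 0" "\<epsilon> > 0"
    "\<forall>B c d. (\<forall>v\<in>{c..d}. \<bar>A' v - \<alpha>\<bar> \<le> \<epsilon>) \<longrightarrow>
       (\<exists>\<eta>>0. \<eta> \<le> 1 \<and> cone_condition \<beta> \<rho> \<nu> B \<eta> c d)"
proof -
  define k where "k = sqrt (2/3)"
  have k: "k > 0" by (simp add: k_def)
  define b where "b = 1 - \<gamma>/2"
  have b: "b > 0" using \<gamma>_less by (simp add: b_def)
  obtain \<beta> \<rho> \<nu> \<mu> where nu: "\<nu> > 0" and mu: "\<mu> > 0" and form:
    "\<And>Y P. 2*Y*(\<alpha>*P - b*Y) + 2*\<beta>*((\<alpha>*P - b*Y)*P + k*Y\<^sup>2) + 2*\<rho>*k*Y*P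
        + 2*\<nu>*(Y\<^sup>2 + 2*\<beta>*Y*P + \<rho>*P\<^sup>2) \<le> - \<mu> * (Y\<^sup>2 + P\<^sup>2)"
    by (rule quadratic_form_exists[OF b k]) (rule that)
  \<comment> \<open>The rate \<gamma> is that of the x direction: -2 X (\<gamma>/2 X) = -\<gamma>
    X^2. Half of m is spent on the \<epsilon> error, half on the \<eta> error.\<close>
  define m where "m = min \<mu> \<gamma>"
  have m: "m > 0" using mu \<gamma>_pos by (simp add: m_def)
  define \<epsilon> where "\<epsilon> = m / (2 * (2 + 2 * \<bar>\<beta>\<bar>))"
  have \<epsilon>: "\<epsilon> > 0" "(2 + 2 * \<bar>\<beta>\<bar>) * \<epsilon> = m / 2" using m by (auto simp: \<epsilon>_def field_simps)
  have "\<exists>\<eta>>0. \<eta> \<le> 1 \<and> cone_condition \<beta> \<rho> \<nu> B \<eta> c d" if A': "\<And>v. v \<in> {c..d} \<Longrightarrow> \<bar>A' v - \<alpha>\<bar> \<le> \<epsilon>" for B c d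
  proof -
    obtain C1 where C1: "C1 \<ge> 0" "\<And>\<eta> p. 0 < \<eta> \<Longrightarrow> \<eta> \<le> 1 \<Longrightarrow> p \<in> slab B \<eta> \<Longrightarrow> \<bar>Rx p\<bar> \<le> C1 * \<eta>"
      "\<And>\<eta> p q. 0 < \<eta> \<Longrightarrow> \<eta> \<le> 1 \<Longrightarrow> p \<in> slab B \<eta> \<Longrightarrow> q \<in> slab B \<eta> \<Longrightarrow> \<bar>Rx p - Rx q\<bar> \<le> C1 * \<eta> * dist p q"
      by (rule small_lipschitzE[OF small_Rx_Ry(2)[of B]]) blast
    obtain C2 where C2: "C2 \<ge> 0" "\<And>\<eta> p. 0 < \<eta> \<Longrightarrow> \<eta> \<le> 1 \<Longrightarrow> p \<in> slab B \<eta> \<Longrightarrow> \<bar>Ry p\<bar> \<le> C2 * \<eta>"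
      "\<And>\<eta> p q. 0 < \<eta> \<Longrightarrow> \<eta> \<le> 1 \<Longrightarrow> p \<in> slab B \<eta> \<Longrightarrow> q \<in> slab B \<eta> \<Longrightarrow> \<bar>Ry p - Ry q\<bar> \<le> C2 * \<eta> * dist p q"
      by (rule small_lipschitzE[OF small_Rx_Ry(3)[of B]]) blast
    \<comment> \<open>The summand 1 keeps C positive when both remainders have constant 0.\<close>
    define C where "C = (2 + 2 * \<bar>\<beta>\<bar>) * C2 + 2 * C1 + 1"
    have "(2 + 2 * \<bar>\<beta>\<bar>) * C2 \<ge> 0" using C2(1) by simp
    then have C: "C > 0" using C1(1) by (simp add: C_def)
    define \<eta> where "\<eta> = min 1 (m / (2 * C))"
    have \<eta>: "\<eta> > 0" "\<eta> \<le> 1" using m C by (auto simp: \<eta>_def)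
    have "\<eta> \<le> m / (2 * C)" by (simp add: \<eta>_def)
    then have "C * \<eta> \<le> m / 2" using C by (simp add: pos_le_divide_eq mult_ac)
    moreover have "C * \<eta> = ((2 + 2 * \<bar>\<beta>\<bar>) * C2 + 2 * C1) * \<eta> + \<eta>" by (simp add: C_def distrib_right)
    ultimately have C\<eta>: "((2 + 2 * \<bar>\<beta>\<bar>) * C2 + 2 * C1) * \<eta> \<le> m / 2" using \<eta> by linarith
    have "cone_condition \<beta> \<rho> \<nu> B \<eta> c d"
      unfolding cone_condition_def Let_def
    proof (intro ballI impI)
      fix p q assume pq: "p \<in> slab B \<eta>" "q \<in> slab B \<eta>" and cd: "snd (snd p) \<in> {c..d}" "snd (snd q) \<in> {c..d}"
      define X Y P where "X = fst p - fst q" and "Y = fst (snd p) - fst (snd q)" and "P = snd (snd p) - snd (snd q)"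
      define D where "D = dist p q"
      have D: "\<bar>X\<bar> \<le> D" "\<bar>Y\<bar> \<le> D" "\<bar>P\<bar> \<le> D" "D \<ge> 0"
        unfolding X_def Y_def P_def D_def by (simp_all add: dist_coordinates3)
      have D2: "D\<^sup>2 = X\<^sup>2 + Y\<^sup>2 + P\<^sup>2"
        unfolding D_def X_def Y_def P_def dist_prod_def by (simp add: dist_real_def)
      define e f where "e = (Gy p - Gy q) - (\<alpha>*P - b*Y)" and "f = (Gx p - Gx q) - \<gamma>/2*X"
      have f: "f = Rx p - Rx q" unfolding f_def Gx_def X_def right_diff_distrib by simp
      have f': "\<bar>f\<bar> \<le> C1 * \<eta> * D" unfolding f D_def using C1(3) \<eta> pq by blast
      have e: "e = (A (snd (snd p)) - A (snd (snd q)) - \<alpha> * P) + (Ry p - Ry q)"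
        by (simp add: e_def Gy_def Y_def P_def b_def algebra_simps)
      have "norm ((A (snd (snd p)) - \<alpha> * snd (snd p)) - (A (snd (snd q)) - \<alpha> * snd (snd q))) \<le> \<epsilon> * norm (snd (snd p) - snd (snd q))"
      proof (rule field_differentiable_bound)
        fix v assume v: "v \<in> {c..d}"
        show "((\<lambda>v. A v - \<alpha> * v) has_real_derivative A' v - \<alpha>) (at v within {c..d})"
          by (rule has_field_derivative_at_within) (use A_deriv in \<open>auto intro!: derivative_eq_intros\<close>)
        show "norm (A' v - \<alpha>) \<le> \<epsilon>" using A'[OF v] by simp
      qed (use cd in auto)
      then have "\<bar>A (snd (snd p)) - A (snd (snd q)) - \<alpha> * P\<bar> \<le> \<epsilon> * \<bar>P\<bar>"
        by (simp add: P_def algebra_simps)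
      also have "\<dots> \<le> \<epsilon> * D" using D \<epsilon> by (intro mult_left_mono) auto
      finally have "\<bar>A (snd (snd p)) - A (snd (snd q)) - \<alpha> * P\<bar> \<le> \<epsilon> * D" .
      moreover have "\<bar>Ry p - Ry q\<bar> \<le> C2 * \<eta> * D" unfolding D_def using C2(3) \<eta> pq by blast
      ultimately have e': "\<bar>e\<bar> \<le> (\<epsilon> + C2 * \<eta>) * D" unfolding e distrib_right by linarith
      have pr: "a * c \<le> r * D\<^sup>2" if "\<bar>a\<bar> \<le> D" "\<bar>c\<bar> \<le> r * D" for a c r
      proof -
        have "a * c \<le> \<bar>a\<bar> * \<bar>c\<bar>" by (simp flip: abs_mult)
        also have "\<dots> \<le> D * (r * D)" using that by (intro mult_mono) auto
        finally show ?thesis by (simp add: power2_eq_square mult_ac)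
      qed
      have 1: "Y * e \<le> (\<epsilon> + C2 * \<eta>) * D\<^sup>2" by (rule pr[OF D(2) e'])
      have 2: "\<beta> * (P * e) \<le> \<bar>\<beta>\<bar> * ((\<epsilon> + C2 * \<eta>) * D\<^sup>2)"
      proof -
        have "\<bar>P * e\<bar> \<le> (\<epsilon> + C2 * \<eta>) * D\<^sup>2" using pr[OF D(3) e'] pr[of "-P" e, OF _ e'] D(3) by (simp add: abs_le_iff)
        then have "\<bar>\<beta>\<bar> * \<bar>P * e\<bar> \<le> \<bar>\<beta>\<bar> * ((\<epsilon> + C2 * \<eta>) * D\<^sup>2)" by (intro mult_left_mono) auto
        then show ?thesis by (metis abs_ge_self abs_mult order_trans)
      qed
      \<comment> \<open>The -X^2 in the form contributes -2\<nu> X^2, which has the favourable sign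
        and is dropped.\<close>
      have 4: "0 \<le> 2 * \<nu> * X\<^sup>2" using nu by simp
      have 3: "- X * f \<le> C1 * \<eta> * D\<^sup>2" by (rule pr) (use D f' in auto)
      have "2 * Y * (Gy p - Gy q) + 2 * \<beta> * ((Gy p - Gy q) * P + Y * (k * Y)) + 2 * \<rho> * P * (k * Y) - 2 * X * (Gx p - Gx q)
           + 2 * \<nu> * (Y\<^sup>2 + 2 * \<beta> * Y * P + \<rho> * P\<^sup>2 - X\<^sup>2)
        = (2*Y*(\<alpha>*P - b*Y) + 2*\<beta>*((\<alpha>*P - b*Y)*P + k*Y\<^sup>2) + 2*\<rho>*k*Y*P
            + 2*\<nu>*(Y\<^sup>2 + 2*\<beta>*Y*P + \<rho>*P\<^sup>2)) + 2 * (Y * e) + 2 * (\<beta> * (P * e)) + 2 * (- X * f) - \<gamma> * X\<^sup>2 - 2 * \<nu> * X\<^sup>2"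
        unfolding e_def f_def by (simp add: algebra_simps power2_eq_square)
      also have "\<dots> \<le> - \<mu> * (Y\<^sup>2 + P\<^sup>2) + 2 * ((\<epsilon> + C2 * \<eta>) * D\<^sup>2) + 2 * (\<bar>\<beta>\<bar> * ((\<epsilon> + C2 * \<eta>) * D\<^sup>2))
          + 2 * (C1 * \<eta> * D\<^sup>2) - \<gamma> * X\<^sup>2"
        using form[of Y P] 1 2 3 4 by linarith
      also have "\<dots> = - (\<mu> * (Y\<^sup>2 + P\<^sup>2)) - \<gamma> * X\<^sup>2 + ((2 + 2 * \<bar>\<beta>\<bar>) * \<epsilon> + ((2 + 2 * \<bar>\<beta>\<bar>) * C2 + 2 * C1) * \<eta>) * D\<^sup>2"
        by (simp add: algebra_simps)
      also have "\<dots> \<le> - (m * (Y\<^sup>2 + P\<^sup>2)) - m * X\<^sup>2 + (m / 2 + m / 2) * D\<^sup>2"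
      proof -
        have "m * (Y\<^sup>2 + P\<^sup>2) \<le> \<mu> * (Y\<^sup>2 + P\<^sup>2)" "m * X\<^sup>2 \<le> \<gamma> * X\<^sup>2"
          by (intro mult_right_mono; simp add: m_def)+
        moreover have "((2 + 2 * \<bar>\<beta>\<bar>) * \<epsilon> + ((2 + 2 * \<bar>\<beta>\<bar>) * C2 + 2 * C1) * \<eta>) * D\<^sup>2 \<le> (m / 2 + m / 2) * D\<^sup>2"
          using \<epsilon>(2) C\<eta> by (intro mult_right_mono add_mono) auto
        ultimately show ?thesis by linarith
      qed
      also have "\<dots> = 0" unfolding D2 by (simp add: algebra_simps)
      finally show "2 * (fst (snd p) - fst (snd q)) * (Gy p - Gy q) +
           2 * \<beta> * ((Gy p - Gy q) * (snd (snd p) - snd (snd q)) +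
            (fst (snd p) - fst (snd q)) * (sqrt (2/3) * (fst (snd p) - fst (snd q)))) +
           2 * \<rho> * (snd (snd p) - snd (snd q)) * (sqrt (2/3) * (fst (snd p) - fst (snd q))) -
           2 * (fst p - fst q) * (Gx p - Gx q)
           \<le> - 2 * \<nu> * ((fst (snd p) - fst (snd q))\<^sup>2 +
             2 * \<beta> * (fst (snd p) - fst (snd q)) * (snd (snd p) - snd (snd q)) +
             \<rho> * (snd (snd p) - snd (snd q))\<^sup>2 - (fst p - fst q)\<^sup>2)"
        unfolding X_def Y_def P_def k_def by simp
    qed
    then show ?thesis using \<eta> by blast
  qed
  then have "\<forall>B c d. (\<forall>v\<in>{c..d}. \<bar>A' v - \<alpha>\<bar> \<le> \<epsilon>) \<longrightarrow>
       (\<exists>\<eta>>0. \<eta> \<le> 1 \<and> cone_condition \<beta> \<rho> \<nu> B \<eta> c d)"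
    by blast
  then show thesis by (rule that[OF nu \<epsilon>(1)])
qed

end

subsection \<open>The exceptional set is negligible\<close>

definition drop_z :: "state \<Rightarrow> real \<times> real \<times> real" where
  "drop_z p = (fst p, fst (snd p), snd (snd (snd p)))"

context bounded_past_orbit begin

lemma drop_z_u: "drop_z (u t) = (x t, y t, \<phi> t)"
  by (simp add: drop_z_def x_def y_def \<phi>_def)

lemma reduced_field:
  assumes "t \<le> 0"
  shows "x' t = Gx (drop_z (u t))" "y' t = Gy (drop_z (u t))" "(z t)\<^sup>2 = 1 - W3 (drop_z (u t))"
proof -
  have W: "W3 (drop_z (u t)) = (y t)\<^sup>2 + w t" by (simp add: W3_def drop_z_u w_def power2_eq_square)
  then show zz: "(z t)\<^sup>2 = 1 - W3 (drop_z (u t))" using components(3)[OF assms] by simp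
  show "x' t = Gx (drop_z (u t))"
    unfolding x'_def zz Gx_def Rx_def W by (simp add: drop_z_u power2_eq_square algebra_simps)
  show "y' t = Gy (drop_z (u t))"
    unfolding y'_eq[OF assms] Gy_def Ry_def R_def W by (simp add: drop_z_u power2_eq_square)
qed

end

section \<open>Comparison of two orbits\<close>

context scalar_field begin

text \<open>A positive value of the quadratic form would grow exponentially into the past, where it is
  bounded.\<close>
lemma cone_pair:
  assumes u: "bounded_past_orbit \<gamma> V \<kappa> B u" and v: "bounded_past_orbit \<gamma> V \<kappa> B v"
    and T: "T < 0" and nu: "\<nu> > 0" and cone: "cone_condition \<beta> \<rho> \<nu> B \<eta> c d"
    and us: "\<And>t. t \<le> T \<Longrightarrow> drop_z (u t) \<in> slab B \<eta> \<and> phi_of (u t) \<in> {c..d}"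
    and vs: "\<And>t. t \<le> T \<Longrightarrow> drop_z (v t) \<in> slab B \<eta> \<and> phi_of (v t) \<in> {c..d}"
  shows "(fst (snd (u T)) - fst (snd (v T)))\<^sup>2
      + 2 * \<beta> * (fst (snd (u T)) - fst (snd (v T))) * (phi_of (u T) - phi_of (v T))
      + \<rho> * (phi_of (u T) - phi_of (v T))\<^sup>2 - (fst (u T) - fst (v T))\<^sup>2 \<le> 0"
proof -
  interpret u: bounded_past_orbit \<gamma> V \<kappa> B u by (rule u)
  interpret v: bounded_past_orbit \<gamma> V \<kappa> B v by (rule v)
  define X Y P where "X t = u.x t - v.x t" and "Y t = u.y t - v.y t" and "P t = u.\<phi> t - v.\<phi> t" for t
  define Q where "Q t = (Y t)\<^sup>2 + 2 * \<beta> * Y t * P t + \<rho> * (P t)\<^sup>2 - (X t)\<^sup>2" for t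
  define DX DY DP where "DX t = u.x' t - v.x' t" and "DY t = u.y' t - v.y' t" and "DP t = sqrt (2/3) * Y t" for t
  define Q' where "Q' t = 2 * Y t * DY t + 2 * \<beta> * (DY t * P t + Y t * DP t) + 2 * \<rho> * P t * DP t - 2 * X t * DX t" for t
  have dQ: "(Q has_real_derivative Q' t) (at t)" if t: "t < 0" for t
  proof -
    have dX: "(X has_real_derivative DX t) (at t)" and dY: "(Y has_real_derivative DY t) (at t)"
      and "(P has_real_derivative sqrt (2/3) * u.y t - sqrt (2/3) * v.y t) (at t)"
      unfolding X_def[abs_def] Y_def[abs_def] P_def[abs_def] DX_def DY_def
      by (intro DERIV_diff u.derivs_at v.derivs_at t)+
    then have dP: "(P has_real_derivative DP t) (at t)" by (simp add: DP_def Y_def right_diff_distrib)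
    show ?thesis unfolding Q_def[abs_def] Q'_def
      by (rule derivative_eq_intros dX dY dP refl | simp add: algebra_simps)+
  qed
  have le: "Q' t \<le> (- 2 * \<nu>) * Q t" if t: "t \<le> T" for t
  proof -
    have t0: "t \<le> 0" using t T by simp
    have a: "phi_of (u t) = u.\<phi> t" "phi_of (v t) = v.\<phi> t" by (simp_all add: phi_of_def u.\<phi>_def v.\<phi>_def)
    note c = cone[unfolded cone_condition_def Let_def, rule_format, of "drop_z (u t)" "drop_z (v t)"]
    have "2 * Y t * (Gy (drop_z (u t)) - Gy (drop_z (v t))) + 2 * \<beta> * ((Gy (drop_z (u t)) - Gy (drop_z (v t))) * P t + Y t * (sqrt (2/3) * Y t))
        + 2 * \<rho> * P t * (sqrt (2/3) * Y t) - 2 * X t * (Gx (drop_z (u t)) - Gx (drop_z (v t)))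
      \<le> - 2 * \<nu> * ((Y t)\<^sup>2 + 2 * \<beta> * Y t * P t + \<rho> * (P t)\<^sup>2 - (X t)\<^sup>2)"
      using c us[OF t] vs[OF t] unfolding a u.drop_z_u v.drop_z_u fst_conv snd_conv X_def Y_def P_def by blast
    then show ?thesis
      unfolding Q'_def Q_def DY_def DX_def DP_def u.reduced_field[OF t0] v.reduced_field[OF t0] .
  qed
  have "Q T \<le> 0"
  proof (rule ccontr)
    assume "\<not> Q T \<le> 0"
    then have QT: "Q T > 0" by simp
    \<comment> \<open>Built from |Y| \<le> 2 and |P| \<le> 2|B|; the term -X^2 only lowers the form,
      so this upper estimate contains no bound for x.\<close>
    define K where "K = 4 + 2 * \<bar>\<beta>\<bar> * (2 * (2 * \<bar>B\<bar>)) + \<bar>\<rho>\<bar> * (2 * \<bar>B\<bar>)\<^sup>2"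
    have K: "Q t \<le> K" if t: "t \<le> T" for t
    proof -
      have t0: "t \<le> 0" using t T by simp
      have Y: "\<bar>Y t\<bar> \<le> 2" using u.yz_bounded[OF t0] v.yz_bounded[OF t0] unfolding Y_def by linarith
      have P: "\<bar>P t\<bar> \<le> 2 * \<bar>B\<bar>" using u.components(4)[OF t0] v.components(4)[OF t0] unfolding P_def by linarith
      have "(Y t)\<^sup>2 \<le> 2\<^sup>2" using Y by (metis abs_ge_zero power2_abs power_mono)
      then have "(Y t)\<^sup>2 \<le> 4" by simp
      moreover have "2 * \<beta> * Y t * P t \<le> 2 * \<bar>\<beta>\<bar> * (2 * (2 * \<bar>B\<bar>))"
      proof -
        have "\<bar>Y t\<bar> * \<bar>P t\<bar> \<le> 2 * (2 * \<bar>B\<bar>)" using Y P by (intro mult_mono) auto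
        then have "2 * \<bar>\<beta>\<bar> * (\<bar>Y t\<bar> * \<bar>P t\<bar>) \<le> 2 * \<bar>\<beta>\<bar> * (2 * (2 * \<bar>B\<bar>))" by (intro mult_left_mono) auto
        moreover have "2 * \<beta> * Y t * P t \<le> \<bar>2 * \<beta> * Y t * P t\<bar>" by simp
        moreover have "\<bar>2 * \<beta> * Y t * P t\<bar> = 2 * \<bar>\<beta>\<bar> * (\<bar>Y t\<bar> * \<bar>P t\<bar>)" by (simp add: abs_mult)
        ultimately show ?thesis by linarith
      qed
      moreover have "\<rho> * (P t)\<^sup>2 \<le> \<bar>\<rho>\<bar> * (2 * \<bar>B\<bar>)\<^sup>2"
      proof -
        have "(P t)\<^sup>2 \<le> (2 * \<bar>B\<bar>)\<^sup>2" using P by (metis abs_ge_zero power2_abs power_mono)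
        then show ?thesis by (intro mult_mono) auto
      qed
      ultimately show ?thesis unfolding Q_def K_def using zero_le_power2[of "X t"] by linarith
    qed
    \<comment> \<open>Going back by a / (2\<nu>) multiplies the form by at least exp a > a, which
      lifts it above Q T a = K.\<close>
    define a where "a = K / Q T"
    have "a \<ge> 1" using K[of T] QT by (simp add: a_def)
    define t where "t = T - a / (2 * \<nu>)"
    have t: "t \<le> T" using \<open>a \<ge> 1\<close> nu by (simp add: t_def)
    have "Q T \<le> Q t * exp ((- 2 * \<nu>) * (T - t))"
    proof (rule gronwall_le[OF t])
      fix s assume s: "t \<le> s" "s \<le> T"
      show "(Q has_real_derivative Q' s) (at s within {t..T})"
        by (rule has_field_derivative_at_within[OF dQ]) (use s T in simp)
      show "Q' s \<le> (- 2 * \<nu>) * Q s" by (rule le[OF s(2)])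
    qed
    also have "(- 2 * \<nu>) * (T - t) = - a" using nu by (simp add: t_def)
    also have "Q t * exp (- a) \<le> K * exp (- a)" using K[OF t] by simp
    finally have "Q T * exp a \<le> K" by (simp add: exp_minus field_simps)
    moreover have "K < Q T * exp a"
    proof -
      have "a < exp a" using exp_ge_add_one_self[of a] by linarith
      then have "Q T * a < Q T * exp a" using QT by simp
      then show ?thesis using QT by (simp add: a_def)
    qed
    ultimately show False by simp
  qed
  then show ?thesis
    by (simp add: Q_def X_def Y_def P_def u.x_def u.y_def u.\<phi>_def v.x_def v.y_def v.\<phi>_def phi_of_def)
qed

text \<open>Completing the square gives (Y + \<beta> P)^2 \<le> X^2 + (\<beta>^2 - \<rho>) P^2. The
  absolute value under the root covers both signs of \<beta>^2 - \<rho>, that is, indefinite and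
  definite forms in (Y, P).\<close>

lemma abs_le_of_quadratic:
  fixes X Y P :: real
  assumes "Y\<^sup>2 + 2 * \<beta> * Y * P + \<rho> * P\<^sup>2 - X\<^sup>2 \<le> 0"
  shows "\<bar>Y\<bar> \<le> \<bar>X\<bar> + (sqrt \<bar>\<beta>\<^sup>2 - \<rho>\<bar> + \<bar>\<beta>\<bar>) * \<bar>P\<bar>"
proof -
  define r where "r = sqrt \<bar>\<beta>\<^sup>2 - \<rho>\<bar>"
  have r: "r \<ge> 0" "r\<^sup>2 = \<bar>\<beta>\<^sup>2 - \<rho>\<bar>" by (simp_all add: r_def)
  have "(Y + \<beta> * P)\<^sup>2 \<le> X\<^sup>2 + (\<beta>\<^sup>2 - \<rho>) * P\<^sup>2"
    using assms by (simp add: power2_eq_square algebra_simps)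
  also have "\<dots> \<le> X\<^sup>2 + r\<^sup>2 * P\<^sup>2" unfolding r by (intro add_left_mono mult_right_mono) auto
  also have "\<dots> \<le> (\<bar>X\<bar> + r * \<bar>P\<bar>)\<^sup>2"
    using r(1) by (simp add: power2_sum power_mult_distrib)
  finally have "\<bar>Y + \<beta> * P\<bar> \<le> \<bar>X\<bar> + r * \<bar>P\<bar>"
    using r(1) by (simp add: abs_le_square_iff[symmetric] abs_of_nonneg)
  moreover have "\<bar>Y\<bar> \<le> \<bar>Y + \<beta> * P\<bar> + \<bar>\<beta>\<bar> * \<bar>P\<bar>"
    using abs_triangle_ineq4[of "Y + \<beta> * P" "\<beta> * P"] by (simp add: abs_mult)
  ultimately show ?thesis by (simp add: r_def distrib_right)
qed

text \<open>All orbits with bound \<open>B\<close> stay in one box, on which the field has one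
  Lipschitz constant; hence \<open>L\<close> is common to all pairs of orbits and all times
  T.\<close>

lemma orbits_gronwall:
  obtains L where "L \<ge> 0"
    "\<And>u v T. bounded_past_orbit \<gamma> V \<kappa> B u \<Longrightarrow> bounded_past_orbit \<gamma> V \<kappa> B v \<Longrightarrow> T \<le> 0 \<Longrightarrow>
       norm (u 0 - v 0) \<le> exp (- L * T) * norm (u T - v T)"
proof -
  let ?F = "ode_field \<gamma> V \<kappa>"
  obtain X where X: "\<And>p. p \<in> Sigma_state V \<Longrightarrow> \<bar>phi_of p\<bar> \<le> B \<Longrightarrow> fst p \<le> X"
    using Sigma_x_bounded by blast
  obtain L where L: "L \<ge> 0" "\<And>p. p \<in> state_box X B \<Longrightarrow> norm (?F p) \<le> L"
    "\<And>p q. p \<in> state_box X B \<Longrightarrow> q \<in> state_box X B \<Longrightarrow> norm (?F p - ?F q) \<le> L * norm (p - q)"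
    by (rule ode_field_lipschitz[of X B]) blast
  have "norm (u 0 - v 0) \<le> exp (- L * T) * norm (u T - v T)"
    if u: "bounded_past_orbit \<gamma> V \<kappa> B u" and v: "bounded_past_orbit \<gamma> V \<kappa> B v" and T: "T \<le> 0" for u v T
  proof -
    interpret u: bounded_past_orbit \<gamma> V \<kappa> B u by (rule u)
    interpret v: bounded_past_orbit \<gamma> V \<kappa> B v by (rule v)
    define D where "D t = (u t - v t) \<bullet> (u t - v t)" for t
    have "D 0 \<le> D T * exp ((2 * L) * (0 - T))"
    proof (rule gronwall_le[OF T])
      fix t assume t: "T \<le> t" "t \<le> 0"
      have d: "((\<lambda>t. u t - v t) has_vector_derivative ?F (u t) - ?F (v t)) (at t within {T..0})"
        using has_vector_derivative_within_subset[OF has_vector_derivative_diff[OF u.u_deriv[OF t(2)] v.u_deriv[OF t(2)]], of "{T..0}"] by auto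
      show "(D has_real_derivative 2 * ((u t - v t) \<bullet> (?F (u t) - ?F (v t)))) (at t within {T..0})"
        unfolding has_real_derivative_iff_has_vector_derivative D_def[abs_def]
        using bounded_bilinear.has_vector_derivative[OF bounded_bilinear_inner d d]
        by (simp add: inner_commute)
      have "(u t - v t) \<bullet> (?F (u t) - ?F (v t)) \<le> norm (u t - v t) * norm (?F (u t) - ?F (v t))"
        by (rule norm_cauchy_schwarz)
      also have "\<dots> \<le> norm (u t - v t) * (L * norm (u t - v t))"
        by (intro mult_left_mono L(3) u.u_in_box[OF X t(2)] v.u_in_box[OF X t(2)]) auto
      also have "\<dots> = L * D t" by (simp add: D_def power2_norm_eq_inner[symmetric] power2_eq_square)
      finally show "2 * ((u t - v t) \<bullet> (?F (u t) - ?F (v t))) \<le> 2 * L * D t" by simp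
    qed
    also have "exp ((2 * L) * (0 - T)) = (exp (- L * T))\<^sup>2" by (simp add: power2_eq_square flip: exp_add)
    finally have "(norm (u 0 - v 0))\<^sup>2 \<le> (exp (- L * T) * norm (u T - v T))\<^sup>2"
      by (simp add: D_def power2_norm_eq_inner power_mult_distrib mult.commute)
    then show ?thesis by (rule power2_le_imp_le) simp
  qed
  then show thesis using that[OF L(1)] by blast
qed

text \<open>The elements are orbits and not points, so that states at times T and 0 can be related
  without a flow map. The bound 1/2 makes z a Lipschitz function of the other coordinates through
  z^2 = 1 - W3.\<close>

definition trapped_orbits :: "real \<Rightarrow> real \<Rightarrow> real \<Rightarrow> real \<Rightarrow> real \<Rightarrow> (real \<Rightarrow> state) set" where
  "trapped_orbits B T \<eta> c d = {u. bounded_past_orbit \<gamma> V \<kappa> B u \<and>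
     (\<forall>t\<le>T. drop_z (u t) \<in> slab B \<eta> \<and> phi_of (u t) \<in> {c..d} \<and> fst (snd (snd (u t))) \<ge> 1/2)}"

lemma negligible_trapped_orbits:
  assumes T: "T < 0" and nu: "\<nu> > 0" and cone: "cone_condition \<beta> \<rho> \<nu> B \<eta> c d"
    and \<eta>: "0 < \<eta>" "\<eta> \<le> 1"
  shows "negligible ((\<lambda>u. chart (u 0)) ` trapped_orbits B T \<eta> c d)"
proof -
  define U where "U = trapped_orbits B T \<eta> c d"
  \<comment> \<open>The middle coordinate 0 replaces y and places the image in a hyperplane, which
    is the source of negligibility.\<close>
  define f :: "(real \<Rightarrow> state) \<Rightarrow> real \<times> real \<times> real" where "f u = (fst (u T), 0, phi_of (u T))" for u
  obtain L where L: "L \<ge> 0"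
    "\<And>u v T. bounded_past_orbit \<gamma> V \<kappa> B u \<Longrightarrow> bounded_past_orbit \<gamma> V \<kappa> B v \<Longrightarrow> T \<le> 0 \<Longrightarrow>
       norm (u 0 - v 0) \<le> exp (- L * T) * norm (u T - v T)"
    by (rule orbits_gronwall[of B]) blast
  obtain C where C: "C \<ge> 0" "\<And>\<eta> p. 0 < \<eta> \<Longrightarrow> \<eta> \<le> 1 \<Longrightarrow> p \<in> slab B \<eta> \<Longrightarrow> \<bar>W3 p\<bar> \<le> C * \<eta>"
    "\<And>\<eta> p q. 0 < \<eta> \<Longrightarrow> \<eta> \<le> 1 \<Longrightarrow> p \<in> slab B \<eta> \<Longrightarrow> q \<in> slab B \<eta> \<Longrightarrow> \<bar>W3 p - W3 q\<bar> \<le> C * \<eta> * dist p q"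
    by (rule small_lipschitzE[OF small_Rx_Ry(1)[of B]]) blast
  define r where "r = sqrt \<bar>\<beta>\<^sup>2 - \<rho>\<bar> + \<bar>\<beta>\<bar>"
  have r: "r \<ge> 0" by (simp add: r_def)
  \<comment> \<open>X and P cost 1 each and Y costs 1 + r by the cone; Z costs C \<eta> times their
    sum.\<close>
  define K where "K = (1 + C * \<eta>) * (3 + r)"
  have "negligible ((\<lambda>u. chart (u 0)) ` U)"
  proof (rule negligible_expanding[where f = f])
    have "negligible {p :: real \<times> real \<times> real. (0, 1, 0) \<bullet> p = 0}"
      by (rule negligible_hyperplane) (simp add: zero_prod_def)
    then show "negligible (f ` U)" by (rule negligible_subset) (auto simp: f_def)
    fix u v assume uv: "u \<in> U" "v \<in> U"
    have ub: "bounded_past_orbit \<gamma> V \<kappa> B u" and vb: "bounded_past_orbit \<gamma> V \<kappa> B v"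
      and us: "\<And>t. t \<le> T \<Longrightarrow> drop_z (u t) \<in> slab B \<eta> \<and> phi_of (u t) \<in> {c..d}"
      and vs: "\<And>t. t \<le> T \<Longrightarrow> drop_z (v t) \<in> slab B \<eta> \<and> phi_of (v t) \<in> {c..d}"
      and uz: "fst (snd (snd (u T))) \<ge> 1/2" and vz: "fst (snd (snd (v T))) \<ge> 1/2"
      using uv unfolding U_def trapped_orbits_def by auto
    interpret u: bounded_past_orbit \<gamma> V \<kappa> B u by (rule ub)
    interpret v: bounded_past_orbit \<gamma> V \<kappa> B v by (rule vb)
    define X Y P Z where "X = fst (u T) - fst (v T)" and "Y = fst (snd (u T)) - fst (snd (v T))"
      and "P = phi_of (u T) - phi_of (v T)" and "Z = fst (snd (snd (u T))) - fst (snd (snd (v T)))"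
    define N where "N = norm (f u - f v)"
    have "Y\<^sup>2 + 2 * \<beta> * Y * P + \<rho> * P\<^sup>2 - X\<^sup>2 \<le> 0"
      unfolding X_def Y_def P_def by (rule cone_pair[OF ub vb T nu cone us vs])
    then have Y: "\<bar>Y\<bar> \<le> \<bar>X\<bar> + r * \<bar>P\<bar>" unfolding r_def by (rule abs_le_of_quadratic)
    have XP: "\<bar>X\<bar> \<le> N" "\<bar>P\<bar> \<le> N"
      using dist_coordinates3[of "f u" "f v"] by (simp_all add: f_def X_def P_def N_def dist_norm)
    then have "r * \<bar>P\<bar> \<le> r * N" using r by (intro mult_left_mono) auto
    then have YN: "\<bar>X\<bar> + \<bar>Y\<bar> + \<bar>P\<bar> \<le> (3 + r) * N" using XP Y by (simp add: distrib_right)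
    have N: "N \<ge> 0" by (simp add: N_def)
    have Z: "\<bar>Z\<bar> \<le> C * \<eta> * ((3 + r) * N)"
    proof -
      \<comment> \<open>The two values of z add up to at least 1, so their difference is at most the
        difference of their squares.\<close>
      have "\<bar>Z\<bar> * 1 \<le> \<bar>Z\<bar> * \<bar>u.z T + v.z T\<bar>"
        using uz vz by (intro mult_left_mono) (auto simp: u.z_def v.z_def)
      also have "\<dots> = \<bar>(u.z T)\<^sup>2 - (v.z T)\<^sup>2\<bar>"
        by (simp add: Z_def u.z_def v.z_def power2_eq_square algebra_simps flip: abs_mult)
      also have "\<dots> = \<bar>W3 (drop_z (u T)) - W3 (drop_z (v T))\<bar>"
        using u.reduced_field(3)[of T] v.reduced_field(3)[of T] T by simp
      also have "\<dots> \<le> C * \<eta> * dist (drop_z (u T)) (drop_z (v T))"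
        using C(3) \<eta> us[of T] vs[of T] by blast
      also have "dist (drop_z (u T)) (drop_z (v T)) \<le> \<bar>X\<bar> + \<bar>Y\<bar> + \<bar>P\<bar>"
      proof -
        have "dist (drop_z (u T)) (drop_z (v T)) = norm (X, Y, P)"
          by (simp add: dist_norm drop_z_def X_def Y_def P_def phi_of_def)
        also have "\<dots> \<le> \<bar>X\<bar> + (\<bar>Y\<bar> + \<bar>P\<bar>)"
          using norm_Pair_le[of X "(Y, P)"] norm_Pair_le[of Y P] by simp
        finally show ?thesis by simp
      qed
      also note YN
      finally show ?thesis using C(1) \<eta> by (simp add: mult_left_mono)
    qed
    have "norm (u T - v T) \<le> \<bar>X\<bar> + \<bar>Y\<bar> + \<bar>Z\<bar> + \<bar>P\<bar>"
      using norm_state_le[of "u T - v T"] by (simp add: X_def Y_def Z_def P_def phi_of_def)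
    also have "\<dots> \<le> K * N" using YN Z by (simp add: K_def algebra_simps)
    finally have "norm (u T - v T) \<le> K * N" .
    then have "exp (- L * T) * norm (u T - v T) \<le> exp (- L * T) * (K * N)" by (intro mult_left_mono) auto
    moreover have "norm (u 0 - v 0) \<le> exp (- L * T) * norm (u T - v T)" using L(2)[OF ub vb] T by simp
    moreover have "norm (chart (u 0) - chart (v 0)) \<le> norm (u 0 - v 0)"
      using dist_snd_le[of "u 0" "v 0"] by (simp add: chart_def dist_norm)
    ultimately have "norm (chart (u 0) - chart (v 0)) \<le> exp (- L * T) * (K * N)" by linarith
    then show "norm (chart (u 0) - chart (v 0)) \<le> (exp (- L * T) * K) * norm (f u - f v)"
      unfolding N_def mult.assoc .
  qed
  then show ?thesis by (simp add: U_def)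
qed

section \<open>Reduction to countably many parameters\<close>

lemma cone_condition_mono:
  assumes "cone_condition \<beta> \<rho> \<nu> B \<eta> c d" "\<eta>' \<le> \<eta>"
  shows "cone_condition \<beta> \<rho> \<nu> B \<eta>' c d"
proof -
  have "slab B \<eta>' \<subseteq> slab B \<eta>" using assms(2) by (auto simp: slab_def)
  then show ?thesis using assms(1) unfolding cone_condition_def Let_def by (meson subsetD)
qed

lemma bounded_past_orbit_mono:
  "bounded_past_orbit \<gamma> V \<kappa> B u \<Longrightarrow> B \<le> B' \<Longrightarrow> bounded_past_orbit \<gamma> V \<kappa> B' u"
  unfolding bounded_past_orbit_def bounded_past_orbit_axioms_def by (meson order_trans)

text \<open>Rounding goes the harmless way: B up to n, \<eta> down to 1 / (m + 1), the entry time
  down to -(k + 1). The bound is rounded before the cone condition is obtained, because that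
  condition refers to it. \<open>Suc\<close> keeps the width finite and the time negative for every
  index.\<close>

lemma orbit_trapped:
  assumes u: "bounded_past_orbit \<gamma> V \<kappa> B u" and z0: "fst (snd (snd (u 0))) > 0"
  obtains \<beta> \<rho> \<nu> c d and n m k :: nat where "\<nu> > 0" "c \<in> \<rat>" "d \<in> \<rat>"
    "cone_condition \<beta> \<rho> \<nu> (real n) (1 / real (Suc m)) c d"
    "u \<in> trapped_orbits (real n) (- real (Suc k)) (1 / real (Suc m)) c d"
proof -
  obtain n :: nat where n: "B \<le> real n" using real_arch_simple by blast
  have un: "bounded_past_orbit \<gamma> V \<kappa> (real n) u" using bounded_past_orbit_mono[OF u n] .
  interpret bounded_past_orbit \<gamma> V \<kappa> "real n" u by (rule un)
  have z0': "z 0 > 0" using z0 by (simp add: z_def)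
  obtain \<alpha> where \<alpha>: "\<And>e. e > 0 \<Longrightarrow> \<exists>c\<in>\<rat>. \<exists>d\<in>\<rat>. (\<forall>v\<in>{c..d}. \<bar>A' v - \<alpha>\<bar> \<le> e) \<and> (\<forall>\<^sub>F t in at_bot. \<phi> t \<in> {c..d})"
    by (rule limit_interval[OF z0']) (rule that)
  obtain \<beta> \<rho> \<nu> \<epsilon> where nu: "\<nu> > 0" and eps: "\<epsilon> > 0" and cone:
    "\<forall>B c d. (\<forall>v\<in>{c..d}. \<bar>A' v - \<alpha>\<bar> \<le> \<epsilon>) \<longrightarrow>
       (\<exists>\<eta>>0. \<eta> \<le> 1 \<and> cone_condition \<beta> \<rho> \<nu> B \<eta> c d)"
    by (rule cone_condition_exists[where \<alpha> = \<alpha>], erule that)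
  obtain c d where cd: "c \<in> \<rat>" "d \<in> \<rat>" "\<And>v. v \<in> {c..d} \<Longrightarrow> \<bar>A' v - \<alpha>\<bar> \<le> \<epsilon>"
    and ev: "\<forall>\<^sub>F t in at_bot. \<phi> t \<in> {c..d}"
    using \<alpha>[OF eps] by blast
  obtain \<eta> where \<eta>: "\<eta> > 0" "cone_condition \<beta> \<rho> \<nu> (real n) \<eta> c d" using cone cd(3) by blast
  obtain m :: nat where m: "1 / real (Suc m) < \<eta>" using nat_approx_posE[OF \<eta>(1)] by blast
  define e where "e = 1 / real (Suc m)"
  have e: "e > 0" by (simp add: e_def)
  have "\<forall>\<^sub>F t in at_bot. t < 0 \<and> \<bar>x t\<bar> < e \<and> \<bar>y t\<bar> < e \<and> z t > 1/2 \<and> \<phi> t \<in> {c..d}"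
    using eventually_neg tendstoD[OF x_null[OF z0'] e] tendstoD[OF y_null[OF z0'] e]
      order_tendstoD(1)[OF z_tendsto[OF z0'], of "1/2"] ev
    by (simp add: eventually_conj_iff dist_real_def)
  then obtain T where T: "\<And>t. t \<le> T \<Longrightarrow> t < 0 \<and> \<bar>x t\<bar> < e \<and> \<bar>y t\<bar> < e \<and> z t > 1/2 \<and> \<phi> t \<in> {c..d}"
    unfolding eventually_at_bot_linorder by blast
  obtain k :: nat where k: "- T \<le> real k" using real_arch_simple by blast
  have "u \<in> trapped_orbits (real n) (- real (Suc k)) e c d"
    unfolding trapped_orbits_def
  proof (intro CollectI conjI allI impI un)
    fix t assume "t \<le> - real (Suc k)"
    then have t: "t \<le> T" using k by simp
    have p: "phi_of (u t) = \<phi> t" by (simp add: phi_of_def \<phi>_def)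
    show "phi_of (u t) \<in> {c..d}" using T[OF t] p by simp
    show "1/2 \<le> fst (snd (snd (u t)))" using T[OF t] by (simp add: z_def)
    have "\<bar>\<phi> t\<bar> \<le> real n" using components(4)[of t] T[OF t] by simp
    then show "drop_z (u t) \<in> slab (real n) e"
      using T[OF t] unfolding drop_z_u slab_def by auto
  qed
  moreover have "cone_condition \<beta> \<rho> \<nu> (real n) e c d"
    by (rule cone_condition_mono[OF \<eta>(2)]) (use m e_def in simp)
  ultimately show thesis using that nu cd(1,2) unfolding e_def by blast
qed

text \<open>The sets \<open>N\<close> do not depend on \<beta>, \<rho>, \<nu>; these real constants
  occur in \<open>Good\<close> only under an existential quantifier, so the union is
  countable.\<close>

lemma negligible_bounded_past:
  "negligible (chart ` {p \<in> Sigma_state V. bdd_above ((\<lambda>q. \<bar>phi_of q\<bar>) ` past_orbit \<gamma> V \<kappa> p)})"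
proof -
  define Good where "Good = {(n :: nat, m :: nat, k :: nat, c :: real, d :: real). c \<in> \<rat> \<and> d \<in> \<rat> \<and>
     (\<exists>\<beta> \<rho> \<nu>. \<nu> > 0 \<and> cone_condition \<beta> \<rho> \<nu> (real n) (1 / real (Suc m)) c d)}"
  define N where "N = (\<lambda>(n :: nat, m :: nat, k :: nat, c, d).
    (\<lambda>u. chart (u 0)) ` trapped_orbits (real n) (- real (Suc k)) (1 / real (Suc m)) c d)"
  have "countable (UNIV \<times> UNIV \<times> UNIV \<times> \<rat> \<times> \<rat> :: (nat \<times> nat \<times> nat \<times> real \<times> real) set)"
    by (intro countable_SIGMA countable_rat) auto
  moreover have "Good \<subseteq> UNIV \<times> UNIV \<times> UNIV \<times> \<rat> \<times> \<rat>" by (auto simp: Good_def)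
  ultimately have "countable (N ` Good)" by (intro countable_image) (rule countable_subset)
  moreover have "negligible S" if "S \<in> N ` Good" for S
  proof -
    obtain n m k c d where g: "(n, m, k, c, d) \<in> Good" and S: "S = N (n, m, k, c, d)" using \<open>S \<in> N ` Good\<close> by auto
    obtain \<beta> \<rho> \<nu> where "\<nu> > 0" "cone_condition \<beta> \<rho> \<nu> (real n) (1 / real (Suc m)) c d"
      using g unfolding Good_def by blast
    then show ?thesis unfolding S N_def prod.case
      by (intro negligible_trapped_orbits) auto
  qed
  ultimately have n1: "negligible (\<Union> (N ` Good))" by (rule negligible_countable_Union)
  \<comment> \<open>The middle coordinate of the chart is z, so this plane takes care of the points
    with z = 0.\<close>
  have n2: "negligible {p :: real \<times> real \<times> real. (0, 1, 0) \<bullet> p = 0}"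
    by (rule negligible_hyperplane) (simp add: zero_prod_def)
  have "chart p \<in> \<Union> (N ` Good) \<union> {p. (0, 1, 0) \<bullet> p = 0}"
    if p: "p \<in> Sigma_state V" and b: "bdd_above ((\<lambda>q. \<bar>phi_of q\<bar>) ` past_orbit \<gamma> V \<kappa> p)" for p
  proof (cases "fst (snd (snd p)) = 0")
    case True
    then show ?thesis by (simp add: chart_def inner_prod_def)
  next
    case False
    obtain x y z \<phi> where e: "p = (x, y, z, \<phi>)" by (cases p) auto
    have "z \<ge> 0" using p unfolding e Sigma_state_def mem_Collect_eq prod.case by blast
    then have zp: "fst (snd (snd p)) > 0" using False by (simp add: e)
    obtain B u where u: "bounded_past_orbit \<gamma> V \<kappa> B u" "u 0 = p" using global_past_orbit[OF p b] by blast
    obtain \<beta> \<rho> \<nu> c d and n m k :: nat where t: "\<nu> > 0" "c \<in> \<rat>" "d \<in> \<rat>"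
      "cone_condition \<beta> \<rho> \<nu> (real n) (1 / real (Suc m)) c d"
      "u \<in> trapped_orbits (real n) (- real (Suc k)) (1 / real (Suc m)) c d"
      by (rule orbit_trapped[OF u(1)]) (use zp u(2) in simp)
    have "(n, m, k, c, d) \<in> Good" using t by (auto simp: Good_def)
    moreover have "chart p \<in> N (n, m, k, c, d)" using t(5) u(2) unfolding N_def prod.case by force
    ultimately show ?thesis by blast
  qed
  then have "chart ` {p \<in> Sigma_state V. bdd_above ((\<lambda>q. \<bar>phi_of q\<bar>) ` past_orbit \<gamma> V \<kappa> p)}
      \<subseteq> \<Union> (N ` Good) \<union> {p. (0, 1, 0) \<bullet> p = 0}"
    by (intro image_subsetI) blast
  then show ?thesis by (rule negligible_subset[OF negligible_Un[OF n1 n2]])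
qed

end

theorem theorem1:
  fixes \<gamma> :: real and V \<kappa> :: "real \<Rightarrow> real"
  assumes "0 < \<gamma>" "\<gamma> < 2" "\<gamma> \<noteq> 4/3"
    and "\<forall>t. V t > 0" "\<forall>t. \<kappa> t > 0"
    and "C3 V" "C3 \<kappa>"
  shows "chart ` {p \<in> Sigma_state V. bdd_above ((\<lambda>q. \<bar>phi_of q\<bar>) ` past_orbit \<gamma> V \<kappa> p)}
           \<in> null_sets lebesgue"
proof -
  interpret scalar_field \<gamma> V \<kappa> by standard (use assms in auto)
  show ?thesis using negligible_bounded_past by (simp add: negligible_iff_null_sets)
qed

end
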